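(* Let $p:\widetilde{\mathcal W}\to\mathcal W$ and $p':\widetilde{\mathcal W}'\to\mathcal W$ be coverings of a $2$-Weyl graph $\mathcal W$ of type $M$. Let $\lambda:\bar p\to\bar p'$ be an isomorphism of the induced groupoid coverings (a groupoid isomorphism $\lambda:\overline{\widetilde{\mathcal W}}\to\overline{\widetilde{\mathcal W}'}$ with $\bar p=\bar p'\circ\lambda$), and let $\mu:p\to p'$ be the unique morphism of coverings such that $\bar\mu=\lambda$. Then $\mu$ is an isomorphism. Thus, if two coverings of a $2$-Weyl graph induce isomorphic groupoid coverings, then they are isomorphic coverings.
   Context: Setting. $M=(m_{st})_{s,t\in S}$ is a Coxeter matrix on a finite set $S$, and $W=\langle S\mid (st)^{m_{st}}=1,\ m_{st}<\infty\rangle$ is its Coxeter group. A word over $S$ is reduced if no shorter word represents the same element of $W$. For $s\ne t$ let $p_m(s,t)=stst\cdots$ ($m$ letters), and if $m_{st}<\infty$ let $p(s,t)=p_{m_{st}}(s,t)$. Groupoids are small and non-empty, with composition $g;h$ (or $gh$) written left to right, defined when $\tau(g)=\iota(h)$, where $\iota,\tau$ denote initial and terminal vertices. Weyl data. A generalized chamber system $\mathcal W$ of type $M$ is a set $\mathcal W_0$ of chambers with a family of groupoids $(\mathcal W_s)_{s\in S}$ (panel groupoids), each with vertex set $\mathcal W_0$. An edge of $\mathcal W$ of type $s$ is a non-identity edge of $\mathcal W_s$ (edges of different types are distinct). An $s$-panel is a connected component of $\mathcal W_s$. A gallery $\beta$ is a finite sequence of consecutive edges (a trivial gallery is a single chamber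 with no edges), with initial chamber $\iota(\beta)$, terminal chamber $\tau(\beta)$, type $\beta_S$ (the word of types of its edges), and $W$-length $\beta_W\in W$ (the element represented by $\beta_S$). It is a cycle if $\iota(\beta)=\tau(\beta)$, and a geodesic if $\beta_S$ is reduced. For $s\neq t$ with $m_{st}<\infty$: an $(s,t)$-geodesic is a geodesic of type $p_m(s,t)$ for some $m$; a maximal $(s,t)$-geodesic is a gallery of type $p(s,t)$; an $(s,t)$-cycle is a cycle of type $p_{2m_{st}}(s,t)$. An alternating geodesic is an $(s,t)$-geodesic for some $s,t$; trivial galleries and one-edge galleries count as alternating geodesics. Weyl data of type $M$ is a generalized chamber system of type $M$ together with, for each ordered pair $(s,t)$ with $s\neq t$, $m_{st}<\infty$, a set of $(s,t)$-cycles called defining suites. Homotopy. Elementary homotopies of galleries are the following moves on subgalleries and their inverses: delete $i\,i^{-1}$; replace $i\,i'$ ($i,i'$ of the same type, $i'\ne i^{-1}$) by the single edge $i;i'$; delete a defining suite. Galleries are homotopic ($\sim$) if related by finitely many such moves. A suite is an $(s,t)$-cycle homotopic to a trivial gallery. The fundamental groupoid $\overline{\mathcal W}$ has vertices the chambers and edges the homotopy classes $[\beta]$ of galleries, with $[\beta];[\beta']=[\beta\beta']$. A morphism $\omega$ of Weyl data induces the groupoid homomorphism $\bar\omega:[\beta]\mapsto[\omega\circ\beta]$. Morphisms and coverings. A morphism of generalized chamber systems of type $M$ is a map on chambers and edges preserving extremities, types and inverses, with $\omega(i;i')=\omega(i);\omega(i')$ whenever $i,i'$ are composable of the same type and $i'\neq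 i^{-1}$. A morphism of Weyl data is such a morphism sending defining suites to suites; an isomorphism of Weyl data is a morphism with an inverse morphism. A morphism is surjective-étale if it is surjective on chambers and, for every chamber $C$, restricts to a bijection from the edges issuing from $C$ to the edges issuing from the image of $C$. A covering $p:\widetilde{\mathcal W}\to\mathcal W$ of Weyl data is a surjective-étale morphism of Weyl data such that every gallery $\beta$ of $\widetilde{\mathcal W}$ with $p\circ\beta$ a defining suite of $\mathcal W$ is a suite of $\widetilde{\mathcal W}$. A morphism of coverings $\mu:p\to p'$ is a morphism of Weyl data $\mu:\widetilde{\mathcal W}\to\widetilde{\mathcal W}'$ with $p=p'\circ\mu$; coverings are isomorphic if there is a morphism between them which is an isomorphism of Weyl data. (For coverings of a $2$-Weyl graph, each morphism $\lambda:\bar p\to\bar p'$ of groupoid coverings is $\bar\mu$ for a unique morphism of coverings $\mu:p\to p'$.) A pre-Weyl graph is Weyl data satisfying (PW0) no panel is a trivial groupoid (one vertex, one edge), and (PW1) each maximal $(s,t)$-geodesic is homotopic to a maximal $(t,s)$-geodesic. A $2$-Weyl graph is a pre-Weyl graph satisfying (2W) homotopic alternating geodesics have the same $W$-length. *)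

theory Defs
  imports "HOL-Library.Extended_Nat" "HOL-Library.FuncSet" "HOL-Algebra.Group"
begin

section \<open>Coxeter matrices and Coxeter groups\<close>

record 's coxeter_matrix =
  gens :: "'s set"
  entry :: "'s \<Rightarrow> 's \<Rightarrow> enat"

definition is_coxeter_matrix :: "'s coxeter_matrix \<Rightarrow> bool" where
  "is_coxeter_matrix M \<longleftrightarrow> finite (gens M) \<and>
     (\<forall>s\<in>gens M. entry M s s = 1) \<and>
     (\<forall>s\<in>gens M. \<forall>t\<in>gens M. s \<noteq> t \<longrightarrow> entry M s t = entry M t s \<and> 2 \<le> entry M s t)"

text \<open>
  The Coxeter group is presented literally: its elements are classes of group words, in which the
  letter \<open>(s, True)\<close> stands for the generator \<open>s\<close> and \<open>(s, False)\<close> for its formal inverse.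
\<close>

type_synonym 's group_word = "('s \<times> bool) list"

definition group_words :: "'s coxeter_matrix \<Rightarrow> 's group_word set" where
  "group_words M = lists (gens M \<times> UNIV)"

inductive group_word_step :: "'s coxeter_matrix \<Rightarrow> 's group_word \<Rightarrow> 's group_word \<Rightarrow> bool"
  for M where
  free_cancel: "u \<in> group_words M \<Longrightarrow> v \<in> group_words M \<Longrightarrow> s \<in> gens M \<Longrightarrow>
     group_word_step M (u @ [(s, b), (s, \<not> b)] @ v) (u @ v)"
| relator: "u \<in> group_words M \<Longrightarrow> v \<in> group_words M \<Longrightarrow> s \<in> gens M \<Longrightarrow> t \<in> gens M \<Longrightarrow>
     entry M s t = enat k \<Longrightarrow>
     group_word_step M (u @ concat (replicate k [(s, True), (t, True)]) @ v) (u @ v)"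

definition word_class :: "'s coxeter_matrix \<Rightarrow> 's group_word \<Rightarrow> 's group_word set" where
  "word_class M u = {v \<in> group_words M. equivclp (group_word_step M) u v}"

definition coxeter_group :: "'s coxeter_matrix \<Rightarrow> 's group_word set monoid" where
  "coxeter_group M =
     \<lparr>carrier = word_class M ` group_words M,
      monoid.mult = (\<lambda>A B. \<Union>a\<in>A. \<Union>b\<in>B. word_class M (a @ b)),
      one = word_class M []\<rparr>"

definition coxeter_gen :: "'s coxeter_matrix \<Rightarrow> 's \<Rightarrow> 's group_word set" where
  "coxeter_gen M s = word_class M [(s, True)]"

primrec word_elem :: "'s coxeter_matrix \<Rightarrow> 's list \<Rightarrow> 's group_word set" where
  "word_elem M [] = \<one>\<^bsub>coxeter_group M\<^esub>"
| "word_elem M (s # w) = coxeter_gen M s \<otimes>\<^bsub>coxeter_group M\<^esub> word_elem M w"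

definition reduced :: "'s coxeter_matrix \<Rightarrow> 's list \<Rightarrow> bool" where
  "reduced M w \<longleftrightarrow> w \<in> lists (gens M) \<and>
     (\<forall>v \<in> lists (gens M). word_elem M v = word_elem M w \<longrightarrow> length w \<le> length v)"

fun alt_word :: "nat \<Rightarrow> 's \<Rightarrow> 's \<Rightarrow> 's list" where
  "alt_word 0 s t = []"
| "alt_word (Suc n) s t = s # alt_word n t s"

definition finite_pair :: "'s coxeter_matrix \<Rightarrow> 's \<Rightarrow> 's \<Rightarrow> bool" where
  "finite_pair M s t \<longleftrightarrow> s \<in> gens M \<and> t \<in> gens M \<and> s \<noteq> t \<and> entry M s t \<noteq> \<infinity>"

definition order_of :: "'s coxeter_matrix \<Rightarrow> 's \<Rightarrow> 's \<Rightarrow> nat" where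
  "order_of M s t = the_enat (entry M s t)"


section \<open>Groupoids\<close>

text \<open>Composition is written left to right: \<open>gcomp G g h\<close> is \<open>g;h\<close>, defined if \<open>g\<close> ends where
  \<open>h\<close> starts.\<close>

record ('v, 'a) groupoid =
  verts :: "'v set"
  arrows :: "'a set"
  gini :: "'a \<Rightarrow> 'v"
  gter :: "'a \<Rightarrow> 'v"
  gcomp :: "'a \<Rightarrow> 'a \<Rightarrow> 'a"
  gid :: "'v \<Rightarrow> 'a"
  ginv :: "'a \<Rightarrow> 'a"

locale groupoid =
  fixes G :: "('v, 'a) groupoid"
  assumes nonempty: "verts G \<noteq> {}"
    and ini_in: "a \<in> arrows G \<Longrightarrow> gini G a \<in> verts G"
    and ter_in: "a \<in> arrows G \<Longrightarrow> gter G a \<in> verts G"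
    and comp_in: "\<lbrakk>a \<in> arrows G; b \<in> arrows G; gter G a = gini G b\<rbrakk> \<Longrightarrow> gcomp G a b \<in> arrows G"
    and ini_comp: "\<lbrakk>a \<in> arrows G; b \<in> arrows G; gter G a = gini G b\<rbrakk> \<Longrightarrow>
          gini G (gcomp G a b) = gini G a"
    and ter_comp: "\<lbrakk>a \<in> arrows G; b \<in> arrows G; gter G a = gini G b\<rbrakk> \<Longrightarrow>
          gter G (gcomp G a b) = gter G b"
    and assoc: "\<lbrakk>a \<in> arrows G; b \<in> arrows G; c \<in> arrows G;
          gter G a = gini G b; gter G b = gini G c\<rbrakk> \<Longrightarrow>
          gcomp G (gcomp G a b) c = gcomp G a (gcomp G b c)"
    and id_in: "v \<in> verts G \<Longrightarrow> gid G v \<in> arrows G"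
    and ini_id: "v \<in> verts G \<Longrightarrow> gini G (gid G v) = v"
    and ter_id: "v \<in> verts G \<Longrightarrow> gter G (gid G v) = v"
    and id_left: "a \<in> arrows G \<Longrightarrow> gcomp G (gid G (gini G a)) a = a"
    and id_right: "a \<in> arrows G \<Longrightarrow> gcomp G a (gid G (gter G a)) = a"
    and inv_in: "a \<in> arrows G \<Longrightarrow> ginv G a \<in> arrows G"
    and ini_inv: "a \<in> arrows G \<Longrightarrow> gini G (ginv G a) = gter G a"
    and ter_inv: "a \<in> arrows G \<Longrightarrow> gter G (ginv G a) = gini G a"
    and inv_right: "a \<in> arrows G \<Longrightarrow> gcomp G a (ginv G a) = gid G (gini G a)"
    and inv_left: "a \<in> arrows G \<Longrightarrow> gcomp G (ginv G a) a = gid G (gter G a)"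

definition component :: "('v, 'a) groupoid \<Rightarrow> 'v \<Rightarrow> ('v, 'a) groupoid" where
  "component G v =
     (let V = {w. \<exists>a\<in>arrows G. gini G a = v \<and> gter G a = w}
      in G\<lparr>verts := V, arrows := {a \<in> arrows G. gini G a \<in> V}\<rparr>)"

definition trivial_groupoid :: "('v, 'a) groupoid \<Rightarrow> bool" where
  "trivial_groupoid G \<longleftrightarrow> (\<exists>v. verts G = {v}) \<and> (\<exists>a. arrows G = {a})"

text \<open>
  A homomorphism is a pair of maps, on vertices and on arrows. Here and for morphisms of chamber
  systems below, maps are extensional, so that equality in HOL is equality of morphisms.
\<close>

definition groupoid_hom ::
    "('v, 'a) groupoid \<Rightarrow> ('w, 'b) groupoid \<Rightarrow> ('v \<Rightarrow> 'w) \<times> ('a \<Rightarrow> 'b) \<Rightarrow> bool" where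
  "groupoid_hom G H f \<longleftrightarrow>
     fst f \<in> verts G \<rightarrow>\<^sub>E verts H \<and> snd f \<in> arrows G \<rightarrow>\<^sub>E arrows H \<and>
     (\<forall>a\<in>arrows G. gini H (snd f a) = fst f (gini G a) \<and> gter H (snd f a) = fst f (gter G a)) \<and>
     (\<forall>a\<in>arrows G. \<forall>b\<in>arrows G. gter G a = gini G b \<longrightarrow>
        snd f (gcomp G a b) = gcomp H (snd f a) (snd f b))"

definition groupoid_compose ::
    "('u, 'a) groupoid \<Rightarrow> ('v \<Rightarrow> 'w) \<times> ('b \<Rightarrow> 'c) \<Rightarrow> ('u \<Rightarrow> 'v) \<times> ('a \<Rightarrow> 'b) \<Rightarrow>
       ('u \<Rightarrow> 'w) \<times> ('a \<Rightarrow> 'c)" where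
  "groupoid_compose G g f =
     (compose (verts G) (fst g) (fst f), compose (arrows G) (snd g) (snd f))"

definition groupoid_ident :: "('v, 'a) groupoid \<Rightarrow> ('v \<Rightarrow> 'v) \<times> ('a \<Rightarrow> 'a)" where
  "groupoid_ident G = (restrict id (verts G), restrict id (arrows G))"

definition groupoid_iso ::
    "('v, 'a) groupoid \<Rightarrow> ('w, 'b) groupoid \<Rightarrow> ('v \<Rightarrow> 'w) \<times> ('a \<Rightarrow> 'b) \<Rightarrow> bool" where
  "groupoid_iso G H f \<longleftrightarrow> groupoid_hom G H f \<and>
     (\<exists>g. groupoid_hom H G g \<and>
        groupoid_compose G g f = groupoid_ident G \<and> groupoid_compose H f g = groupoid_ident H)"


section \<open>Generalized chamber systems and galleries\<close>

text \<open>
  An edge is a pair of its type and a non-identity arrow of the panel groupoid of that type; in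
  particular edges of different types are distinct. A gallery is a pair of its initial chamber and
  its list of edges; \<open>(C, [])\<close> is the trivial gallery at \<open>C\<close>.
\<close>

type_synonym ('s, 'e) edge = "'s \<times> 'e"
type_synonym ('s, 'c, 'e) gallery = "'c \<times> ('s, 'e) edge list"

record ('s, 'c, 'e) chamber_system =
  chambers :: "'c set"
  panel_groupoid :: "'s \<Rightarrow> ('c, 'e) groupoid"

record ('s, 'c, 'e) weyl_data = "('s, 'c, 'e) chamber_system" +
  def_suites :: "'s \<Rightarrow> 's \<Rightarrow> ('s, 'c, 'e) gallery set"

definition is_chamber_system ::
    "'s coxeter_matrix \<Rightarrow> ('s, 'c, 'e, 'z) chamber_system_scheme \<Rightarrow> bool" where
  "is_chamber_system M X \<longleftrightarrow> is_coxeter_matrix M \<and>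
     (\<forall>s\<in>gens M. groupoid (panel_groupoid X s) \<and> verts (panel_groupoid X s) = chambers X)"

definition edges ::
    "'s coxeter_matrix \<Rightarrow> ('s, 'c, 'e, 'z) chamber_system_scheme \<Rightarrow> ('s, 'e) edge set" where
  "edges M X = {(s, a). s \<in> gens M \<and> a \<in> arrows (panel_groupoid X s) \<and>
     a \<notin> gid (panel_groupoid X s) ` verts (panel_groupoid X s)}"

definition edge_ini ::
    "('s, 'c, 'e, 'z) chamber_system_scheme \<Rightarrow> ('s, 'e) edge \<Rightarrow> 'c" where
  "edge_ini X i = gini (panel_groupoid X (fst i)) (snd i)"

definition edge_ter ::
    "('s, 'c, 'e, 'z) chamber_system_scheme \<Rightarrow> ('s, 'e) edge \<Rightarrow> 'c" where
  "edge_ter X i = gter (panel_groupoid X (fst i)) (snd i)"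

definition edge_inv ::
    "('s, 'c, 'e, 'z) chamber_system_scheme \<Rightarrow> ('s, 'e) edge \<Rightarrow> ('s, 'e) edge" where
  "edge_inv X i = (fst i, ginv (panel_groupoid X (fst i)) (snd i))"

text \<open>Used only for composable edges of the same type that are not mutually inverse.\<close>

definition edge_comp ::
    "('s, 'c, 'e, 'z) chamber_system_scheme \<Rightarrow> ('s, 'e) edge \<Rightarrow> ('s, 'e) edge \<Rightarrow>
       ('s, 'e) edge" where
  "edge_comp X i j = (fst i, gcomp (panel_groupoid X (fst i)) (snd i) (snd j))"

definition panels ::
    "('s, 'c, 'e, 'z) chamber_system_scheme \<Rightarrow> 's \<Rightarrow> ('c, 'e) groupoid set" where
  "panels X s = component (panel_groupoid X s) ` chambers X"

fun walk ::
    "'s coxeter_matrix \<Rightarrow> ('s, 'c, 'e, 'z) chamber_system_scheme \<Rightarrow> 'c \<Rightarrow>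
       ('s, 'e) edge list \<Rightarrow> bool" where
  "walk M X C [] \<longleftrightarrow> C \<in> chambers X"
| "walk M X C (i # es) \<longleftrightarrow> i \<in> edges M X \<and> edge_ini X i = C \<and> walk M X (edge_ter X i) es"

definition galleries ::
    "'s coxeter_matrix \<Rightarrow> ('s, 'c, 'e, 'z) chamber_system_scheme \<Rightarrow>
       ('s, 'c, 'e) gallery set" where
  "galleries M X = {(C, es). walk M X C es}"

definition gal_ini :: "('s, 'c, 'e) gallery \<Rightarrow> 'c" where
  "gal_ini \<beta> = fst \<beta>"

definition gal_ter ::
    "('s, 'c, 'e, 'z) chamber_system_scheme \<Rightarrow> ('s, 'c, 'e) gallery \<Rightarrow> 'c" where
  "gal_ter X \<beta> = (if snd \<beta> = [] then fst \<beta> else edge_ter X (last (snd \<beta>)))"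

definition gal_type :: "('s, 'c, 'e) gallery \<Rightarrow> 's list" where
  "gal_type \<beta> = map fst (snd \<beta>)"

definition gal_W_length ::
    "'s coxeter_matrix \<Rightarrow> ('s, 'c, 'e) gallery \<Rightarrow> 's group_word set" where
  "gal_W_length M \<beta> = word_elem M (gal_type \<beta>)"

definition gal_concat ::
    "('s, 'c, 'e) gallery \<Rightarrow> ('s, 'c, 'e) gallery \<Rightarrow> ('s, 'c, 'e) gallery" where
  "gal_concat \<beta> \<gamma> = (fst \<beta>, snd \<beta> @ snd \<gamma>)"

definition gal_reverse ::
    "('s, 'c, 'e, 'z) chamber_system_scheme \<Rightarrow> ('s, 'c, 'e) gallery \<Rightarrow>
       ('s, 'c, 'e) gallery" where
  "gal_reverse X \<beta> = (gal_ter X \<beta>, rev (map (edge_inv X) (snd \<beta>)))"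

definition is_cycle ::
    "'s coxeter_matrix \<Rightarrow> ('s, 'c, 'e, 'z) chamber_system_scheme \<Rightarrow>
       ('s, 'c, 'e) gallery \<Rightarrow> bool" where
  "is_cycle M X \<beta> \<longleftrightarrow> \<beta> \<in> galleries M X \<and> gal_ini \<beta> = gal_ter X \<beta>"

definition is_geodesic ::
    "'s coxeter_matrix \<Rightarrow> ('s, 'c, 'e, 'z) chamber_system_scheme \<Rightarrow>
       ('s, 'c, 'e) gallery \<Rightarrow> bool" where
  "is_geodesic M X \<beta> \<longleftrightarrow> \<beta> \<in> galleries M X \<and> reduced M (gal_type \<beta>)"

definition is_st_geodesic ::
    "'s coxeter_matrix \<Rightarrow> ('s, 'c, 'e, 'z) chamber_system_scheme \<Rightarrow> 's \<Rightarrow> 's \<Rightarrow>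
       ('s, 'c, 'e) gallery \<Rightarrow> bool" where
  "is_st_geodesic M X s t \<beta> \<longleftrightarrow> finite_pair M s t \<and> is_geodesic M X \<beta> \<and>
     (\<exists>n. gal_type \<beta> = alt_word n s t)"

definition is_maximal_st_geodesic ::
    "'s coxeter_matrix \<Rightarrow> ('s, 'c, 'e, 'z) chamber_system_scheme \<Rightarrow> 's \<Rightarrow> 's \<Rightarrow>
       ('s, 'c, 'e) gallery \<Rightarrow> bool" where
  "is_maximal_st_geodesic M X s t \<beta> \<longleftrightarrow> finite_pair M s t \<and> \<beta> \<in> galleries M X \<and>
     gal_type \<beta> = alt_word (order_of M s t) s t"

definition is_st_cycle ::
    "'s coxeter_matrix \<Rightarrow> ('s, 'c, 'e, 'z) chamber_system_scheme \<Rightarrow> 's \<Rightarrow> 's \<Rightarrow>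
       ('s, 'c, 'e) gallery \<Rightarrow> bool" where
  "is_st_cycle M X s t \<beta> \<longleftrightarrow> finite_pair M s t \<and> is_cycle M X \<beta> \<and>
     gal_type \<beta> = alt_word (2 * order_of M s t) s t"

definition is_alternating_geodesic ::
    "'s coxeter_matrix \<Rightarrow> ('s, 'c, 'e, 'z) chamber_system_scheme \<Rightarrow>
       ('s, 'c, 'e) gallery \<Rightarrow> bool" where
  "is_alternating_geodesic M X \<beta> \<longleftrightarrow> (\<exists>s t. is_st_geodesic M X s t \<beta>) \<or>
     (\<beta> \<in> galleries M X \<and> length (snd \<beta>) \<le> 1)"


section \<open>Weyl data, homotopy and the fundamental groupoid\<close>

definition is_weyl_data :: "'s coxeter_matrix \<Rightarrow> ('s, 'c, 'e) weyl_data \<Rightarrow> bool" where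
  "is_weyl_data M X \<longleftrightarrow> is_chamber_system M X \<and>
     (\<forall>s t. finite_pair M s t \<longrightarrow> (\<forall>\<beta>\<in>def_suites X s t. is_st_cycle M X s t \<beta>))"

definition defining_suites ::
    "'s coxeter_matrix \<Rightarrow> ('s, 'c, 'e) weyl_data \<Rightarrow> ('s, 'c, 'e) gallery set" where
  "defining_suites M X = {\<beta>. \<exists>s t. finite_pair M s t \<and> \<beta> \<in> def_suites X s t}"

inductive elementary_homotopy ::
    "'s coxeter_matrix \<Rightarrow> ('s, 'c, 'e) weyl_data \<Rightarrow>
       ('s, 'c, 'e) gallery \<Rightarrow> ('s, 'c, 'e) gallery \<Rightarrow> bool"
  for M X where
  delete_inverse: "(C, u @ [i, edge_inv X i] @ v) \<in> galleries M X \<Longrightarrow>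
     elementary_homotopy M X (C, u @ [i, edge_inv X i] @ v) (C, u @ v)"
| merge: "(C, u @ [i, j] @ v) \<in> galleries M X \<Longrightarrow> fst i = fst j \<Longrightarrow> j \<noteq> edge_inv X i \<Longrightarrow>
     elementary_homotopy M X (C, u @ [i, j] @ v) (C, u @ [edge_comp X i j] @ v)"
| delete_suite: "(C, u @ d @ v) \<in> galleries M X \<Longrightarrow>
     (gal_ter X (C, u), d) \<in> defining_suites M X \<Longrightarrow>
     elementary_homotopy M X (C, u @ d @ v) (C, u @ v)"

definition homotopic ::
    "'s coxeter_matrix \<Rightarrow> ('s, 'c, 'e) weyl_data \<Rightarrow>
       ('s, 'c, 'e) gallery \<Rightarrow> ('s, 'c, 'e) gallery \<Rightarrow> bool" where
  "homotopic M X \<beta> \<gamma> \<longleftrightarrow> \<beta> \<in> galleries M X \<and> \<gamma> \<in> galleries M X \<and>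
     equivclp (elementary_homotopy M X) \<beta> \<gamma>"

definition suites ::
    "'s coxeter_matrix \<Rightarrow> ('s, 'c, 'e) weyl_data \<Rightarrow> ('s, 'c, 'e) gallery set" where
  "suites M X = {\<beta>. (\<exists>s t. is_st_cycle M X s t \<beta>) \<and> (\<exists>C\<in>chambers X. homotopic M X \<beta> (C, []))}"

definition homotopy_class ::
    "'s coxeter_matrix \<Rightarrow> ('s, 'c, 'e) weyl_data \<Rightarrow>
       ('s, 'c, 'e) gallery \<Rightarrow> ('s, 'c, 'e) gallery set" where
  "homotopy_class M X \<beta> = {\<gamma>. homotopic M X \<beta> \<gamma>}"

text \<open>
  The unions below are unions of equal classes: endpoints, concatenation and reversal of galleries
  are compatible with homotopy.
\<close>

definition fundamental_groupoid ::
    "'s coxeter_matrix \<Rightarrow> ('s, 'c, 'e) weyl_data \<Rightarrow>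
       ('c, ('s, 'c, 'e) gallery set) groupoid" where
  "fundamental_groupoid M X =
     \<lparr>verts = chambers X,
      arrows = homotopy_class M X ` galleries M X,
      gini = (\<lambda>A. THE C. \<exists>\<beta>\<in>A. C = gal_ini \<beta>),
      gter = (\<lambda>A. THE C. \<exists>\<beta>\<in>A. C = gal_ter X \<beta>),
      gcomp = (\<lambda>A B. \<Union>{homotopy_class M X (gal_concat \<beta> \<gamma>) | \<beta> \<gamma>.
                 \<beta> \<in> A \<and> \<gamma> \<in> B \<and> gal_ter X \<beta> = gal_ini \<gamma>}),
      gid = (\<lambda>C. homotopy_class M X (C, [])),
      ginv = (\<lambda>A. \<Union>\<beta>\<in>A. homotopy_class M X (gal_reverse X \<beta>))\<rparr>"


section \<open>Morphisms and coverings\<close>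

type_synonym ('s, 'c, 'e, 'd, 'f) weyl_map = "('c \<Rightarrow> 'd) \<times> (('s, 'e) edge \<Rightarrow> ('s, 'f) edge)"

definition gal_map ::
    "('s, 'c, 'e, 'd, 'f) weyl_map \<Rightarrow> ('s, 'c, 'e) gallery \<Rightarrow> ('s, 'd, 'f) gallery" where
  "gal_map \<omega> \<beta> = (fst \<omega> (fst \<beta>), map (snd \<omega>) (snd \<beta>))"

definition chamber_morphism ::
    "'s coxeter_matrix \<Rightarrow> ('s, 'c, 'e, 'y) chamber_system_scheme \<Rightarrow>
       ('s, 'd, 'f, 'z) chamber_system_scheme \<Rightarrow> ('s, 'c, 'e, 'd, 'f) weyl_map \<Rightarrow> bool" where
  "chamber_morphism M X Y \<omega> \<longleftrightarrow>
     fst \<omega> \<in> chambers X \<rightarrow>\<^sub>E chambers Y \<and> snd \<omega> \<in> edges M X \<rightarrow>\<^sub>E edges M Y \<and>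
     (\<forall>i\<in>edges M X. edge_ini Y (snd \<omega> i) = fst \<omega> (edge_ini X i) \<and>
        edge_ter Y (snd \<omega> i) = fst \<omega> (edge_ter X i) \<and>
        fst (snd \<omega> i) = fst i \<and>
        snd \<omega> (edge_inv X i) = edge_inv Y (snd \<omega> i)) \<and>
     (\<forall>i\<in>edges M X. \<forall>j\<in>edges M X.
        fst i = fst j \<and> edge_ter X i = edge_ini X j \<and> j \<noteq> edge_inv X i \<longrightarrow>
        snd \<omega> (edge_comp X i j) = edge_comp Y (snd \<omega> i) (snd \<omega> j))"

definition weyl_morphism ::
    "'s coxeter_matrix \<Rightarrow> ('s, 'c, 'e) weyl_data \<Rightarrow> ('s, 'd, 'f) weyl_data \<Rightarrow>
       ('s, 'c, 'e, 'd, 'f) weyl_map \<Rightarrow> bool" where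
  "weyl_morphism M X Y \<omega> \<longleftrightarrow> chamber_morphism M X Y \<omega> \<and>
     (\<forall>\<beta>\<in>defining_suites M X. gal_map \<omega> \<beta> \<in> suites M Y)"

definition weyl_compose ::
    "'s coxeter_matrix \<Rightarrow> ('s, 'c, 'e) weyl_data \<Rightarrow> ('s, 'd, 'f, 'g, 'h) weyl_map \<Rightarrow>
       ('s, 'c, 'e, 'd, 'f) weyl_map \<Rightarrow> ('s, 'c, 'e, 'g, 'h) weyl_map" where
  "weyl_compose M X \<eta> \<omega> =
     (compose (chambers X) (fst \<eta>) (fst \<omega>), compose (edges M X) (snd \<eta>) (snd \<omega>))"

definition weyl_ident ::
    "'s coxeter_matrix \<Rightarrow> ('s, 'c, 'e) weyl_data \<Rightarrow> ('s, 'c, 'e, 'c, 'e) weyl_map" where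
  "weyl_ident M X = (restrict id (chambers X), restrict id (edges M X))"

definition weyl_iso ::
    "'s coxeter_matrix \<Rightarrow> ('s, 'c, 'e) weyl_data \<Rightarrow> ('s, 'd, 'f) weyl_data \<Rightarrow>
       ('s, 'c, 'e, 'd, 'f) weyl_map \<Rightarrow> bool" where
  "weyl_iso M X Y \<omega> \<longleftrightarrow> weyl_morphism M X Y \<omega> \<and>
     (\<exists>\<eta>. weyl_morphism M Y X \<eta> \<and>
        weyl_compose M X \<eta> \<omega> = weyl_ident M X \<and> weyl_compose M Y \<omega> \<eta> = weyl_ident M Y)"

definition induced_hom ::
    "'s coxeter_matrix \<Rightarrow> ('s, 'c, 'e) weyl_data \<Rightarrow> ('s, 'd, 'f) weyl_data \<Rightarrow>
       ('s, 'c, 'e, 'd, 'f) weyl_map \<Rightarrow>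
       ('c \<Rightarrow> 'd) \<times> (('s, 'c, 'e) gallery set \<Rightarrow> ('s, 'd, 'f) gallery set)" where
  "induced_hom M X Y \<omega> =
     (restrict (fst \<omega>) (verts (fundamental_groupoid M X)),
      \<lambda>A\<in>arrows (fundamental_groupoid M X). \<Union>\<beta>\<in>A. homotopy_class M Y (gal_map \<omega> \<beta>))"

definition surjective_etale ::
    "'s coxeter_matrix \<Rightarrow> ('s, 'c, 'e) weyl_data \<Rightarrow> ('s, 'd, 'f) weyl_data \<Rightarrow>
       ('s, 'c, 'e, 'd, 'f) weyl_map \<Rightarrow> bool" where
  "surjective_etale M X Y \<omega> \<longleftrightarrow> fst \<omega> ` chambers X = chambers Y \<and>
     (\<forall>C\<in>chambers X. bij_betw (snd \<omega>) {i \<in> edges M X. edge_ini X i = C}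
        {i \<in> edges M Y. edge_ini Y i = fst \<omega> C})"

definition covering ::
    "'s coxeter_matrix \<Rightarrow> ('s, 'c, 'e) weyl_data \<Rightarrow> ('s, 'd, 'f) weyl_data \<Rightarrow>
       ('s, 'c, 'e, 'd, 'f) weyl_map \<Rightarrow> bool" where
  "covering M X Y p \<longleftrightarrow> is_weyl_data M X \<and> is_weyl_data M Y \<and>
     weyl_morphism M X Y p \<and> surjective_etale M X Y p \<and>
     (\<forall>\<beta>\<in>galleries M X. gal_map p \<beta> \<in> defining_suites M Y \<longrightarrow> \<beta> \<in> suites M X)"

definition covering_morphism ::
    "'s coxeter_matrix \<Rightarrow>
       ('s, 'c, 'e) weyl_data \<Rightarrow> ('s, 'c, 'e, 'g, 'h) weyl_map \<Rightarrow>
       ('s, 'd, 'f) weyl_data \<Rightarrow> ('s, 'd, 'f, 'g, 'h) weyl_map \<Rightarrow>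
       ('s, 'c, 'e, 'd, 'f) weyl_map \<Rightarrow> bool" where
  "covering_morphism M X p X' p' \<mu> \<longleftrightarrow>
     weyl_morphism M X X' \<mu> \<and> p = weyl_compose M X p' \<mu>"

definition isomorphic_coverings ::
    "'s coxeter_matrix \<Rightarrow>
       ('s, 'c, 'e) weyl_data \<Rightarrow> ('s, 'c, 'e, 'g, 'h) weyl_map \<Rightarrow>
       ('s, 'd, 'f) weyl_data \<Rightarrow> ('s, 'd, 'f, 'g, 'h) weyl_map \<Rightarrow> bool" where
  "isomorphic_coverings M X p X' p' \<longleftrightarrow>
     (\<exists>\<mu>. covering_morphism M X p X' p' \<mu> \<and> weyl_iso M X X' \<mu>)"

definition groupoid_covering_iso ::
    "('v, 'a) groupoid \<Rightarrow> ('v \<Rightarrow> 'u) \<times> ('a \<Rightarrow> 'c) \<Rightarrow>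
       ('w, 'b) groupoid \<Rightarrow> ('w \<Rightarrow> 'u) \<times> ('b \<Rightarrow> 'c) \<Rightarrow>
       ('v \<Rightarrow> 'w) \<times> ('a \<Rightarrow> 'b) \<Rightarrow> bool" where
  "groupoid_covering_iso G q H q' f \<longleftrightarrow> groupoid_iso G H f \<and> q = groupoid_compose G q' f"


section \<open>2-Weyl graphs\<close>

definition pre_weyl_graph :: "'s coxeter_matrix \<Rightarrow> ('s, 'c, 'e) weyl_data \<Rightarrow> bool" where
  "pre_weyl_graph M X \<longleftrightarrow> is_weyl_data M X \<and>
     (\<forall>s\<in>gens M. \<forall>P\<in>panels X s. \<not> trivial_groupoid P) \<and>
     (\<forall>s t \<beta>. is_maximal_st_geodesic M X s t \<beta> \<longrightarrow>
        (\<exists>\<gamma>. is_maximal_st_geodesic M X t s \<gamma> \<and> homotopic M X \<beta> \<gamma>))"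

definition two_weyl_graph :: "'s coxeter_matrix \<Rightarrow> ('s, 'c, 'e) weyl_data \<Rightarrow> bool" where
  "two_weyl_graph M X \<longleftrightarrow> pre_weyl_graph M X \<and>
     (\<forall>\<beta> \<gamma>. is_alternating_geodesic M X \<beta> \<and> is_alternating_geodesic M X \<gamma> \<and>
        homotopic M X \<beta> \<gamma> \<longrightarrow> gal_W_length M \<beta> = gal_W_length M \<gamma>)"

end

theory Submission
  imports Defs
begin

text \<open>
  Elementary homotopies lift along a covering, so two galleries of the covering with the same
  initial chamber are homotopic as soon as their images are. Given \<open>\<lambda>\<close>, let \<open>\<mu>\<close> agree with \<open>\<lambda>\<close> on
  chambers and send an edge \<open>i\<close> at \<open>C\<close> to the edge at \<open>\<lambda> C\<close> lifting \<open>p i\<close>. Both \<open>[\<mu> i]\<close> and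
  \<open>\<lambda> [i]\<close> lift \<open>[p i]\<close> at \<open>\<lambda> C\<close>, so they are equal; hence \<open>\<mu>\<close> preserves terminal chambers, and all
  remaining properties of \<open>\<mu>\<close> follow by unique lifting. The inverse of \<open>\<lambda>\<close> yields the inverse
  of \<open>\<mu>\<close> in the same way.
\<close>

section \<open>Edges and galleries\<close>

lemma edge_ini_in:
  "is_chamber_system M X \<Longrightarrow> i \<in> edges M X \<Longrightarrow> edge_ini X i \<in> chambers X"
  unfolding is_chamber_system_def edges_def edge_ini_def
  \<comment> \<open>\<open>back_subst\<close> trades \<open>verts\<close> of the panel groupoid,
    where the groupoid laws live, for \<open>chambers X\<close>.\<close>
  by (auto intro: groupoid.ini_in[THEN back_subst[where P = "\<lambda>V. _ \<in> V"]])

lemma edge_ter_in: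
  "is_chamber_system M X \<Longrightarrow> i \<in> edges M X \<Longrightarrow> edge_ter X i \<in> chambers X"
  unfolding is_chamber_system_def edges_def edge_ter_def
  by (auto intro: groupoid.ter_in[THEN back_subst[where P = "\<lambda>V. _ \<in> V"]])

text \<open>Edges exclude the identities at all vertices, so the vertex \<open>v\<close> is left
  open here; comparing initial vertices forces it to be \<open>gini G a\<close>, and cancelling
  \<open>a\<close> on the left gives the claim.\<close>

lemma groupoid_inv_eq_if_comp_eq_id:
  assumes G: "groupoid G" and a: "a \<in> arrows G" and b: "b \<in> arrows G" and ab: "gter G a = gini G b"
    and v: "v \<in> verts G" and eq: "gcomp G a b = gid G v"
  shows "b = ginv G a"
proof -
  have vini: "v = gini G a"
    using groupoid.ini_comp[OF G a b ab] groupoid.ini_id[OF G v] eq by simp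
  have "b = gcomp G (gid G (gini G b)) b" using groupoid.id_left[OF G b] by simp
  also have "\<dots> = gcomp G (gcomp G (ginv G a) a) b" using groupoid.inv_left[OF G a] ab by simp
  also have "\<dots> = gcomp G (ginv G a) (gcomp G a b)"
    using groupoid.assoc[OF G groupoid.inv_in[OF G a] a b groupoid.ter_inv[OF G a] ab] .
  also have "\<dots> = gcomp G (ginv G a) (gid G (gter G (ginv G a)))"
    using eq vini groupoid.ter_inv[OF G a] by simp
  also have "\<dots> = ginv G a" using groupoid.id_right[OF G groupoid.inv_in[OF G a]] .
  finally show ?thesis .
qed

text \<open>Such an arrow is a loop at \<open>v\<close>, and composing it with its inverse yields
  both the arrow itself and the identity. Hence edges are closed under inversion.\<close>

lemma groupoid_inv_not_id:
  assumes G: "groupoid G" and a: "a \<in> arrows G" and v: "v \<in> verts G" and eq: "ginv G a = gid G v"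
  shows "a = gid G v"
proof -
  have ter: "gter G a = v" using groupoid.ini_inv[OF G a] groupoid.ini_id[OF G v] eq by simp
  have ini: "gini G a = v" using groupoid.ter_inv[OF G a] groupoid.ter_id[OF G v] eq by simp
  have "gcomp G a (gid G v) = a" using groupoid.id_right[OF G a] ter by simp
  moreover have "gcomp G a (gid G v) = gid G v" using groupoid.inv_right[OF G a] eq ini by simp
  ultimately show ?thesis by simp
qed

section \<open>Inverses and composites of edges\<close>

lemma panel_groupoid_of_edge:
  "is_chamber_system M X \<Longrightarrow> i \<in> edges M X \<Longrightarrow> groupoid (panel_groupoid X (fst i))"
  unfolding is_chamber_system_def edges_def by auto

lemma edge_arrow: "i \<in> edges M X \<Longrightarrow> snd i \<in> arrows (panel_groupoid X (fst i))"
  unfolding edges_def by auto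

lemma fst_edge_inv [simp]: "fst (edge_inv X i) = fst i"
  by (simp add: edge_inv_def)

lemma edge_inv_in:
  assumes X: "is_chamber_system M X" and i: "i \<in> edges M X"
  shows "edge_inv X i \<in> edges M X"
  using i groupoid_inv_not_id[OF panel_groupoid_of_edge[OF X i] edge_arrow[OF i]]
    groupoid.inv_in[OF panel_groupoid_of_edge[OF X i]]
  unfolding edges_def edge_inv_def by auto

lemma edge_ini_inv:
  "is_chamber_system M X \<Longrightarrow> i \<in> edges M X \<Longrightarrow> edge_ini X (edge_inv X i) = edge_ter X i"
  using groupoid.ini_inv[OF panel_groupoid_of_edge edge_arrow]
  by (simp add: edge_inv_def edge_ini_def edge_ter_def)

lemma edge_ter_inv:
  "is_chamber_system M X \<Longrightarrow> i \<in> edges M X \<Longrightarrow> edge_ter X (edge_inv X i) = edge_ini X i"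
  using groupoid.ter_inv[OF panel_groupoid_of_edge edge_arrow]
  by (simp add: edge_inv_def edge_ini_def edge_ter_def)

lemmas edge_inv_props = edge_inv_in edge_ini_inv edge_ter_inv

lemma fst_edge_comp [simp]: "fst (edge_comp X i j) = fst i"
  by (simp add: edge_comp_def)

text \<open>Both directions serve: non-inverse edges merge to an edge, and conversely a composite
  that is known to be an edge certifies that its factors are not mutually inverse.\<close>

lemma edge_comp_in_iff:
  assumes X: "is_chamber_system M X" and i: "i \<in> edges M X" and j: "j \<in> edges M X"
    and s: "fst i = fst j" and ij: "edge_ter X i = edge_ini X j"
  shows "edge_comp X i j \<in> edges M X \<longleftrightarrow> j \<noteq> edge_inv X i"
proof -
  obtain s a b where ia: "i = (s, a)" "j = (s, b)" using s by (cases i; cases j; auto)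
  have G: "groupoid (panel_groupoid X s)" using panel_groupoid_of_edge[OF X i] ia by simp
  have ab: "a \<in> arrows (panel_groupoid X s)" "b \<in> arrows (panel_groupoid X s)" "s \<in> gens M"
    "gter (panel_groupoid X s) a = gini (panel_groupoid X s) b"
    using i j ia ij unfolding edges_def edge_ini_def edge_ter_def by auto
  show ?thesis
    using ab groupoid_inv_eq_if_comp_eq_id[OF G] groupoid.comp_in[OF G]
      groupoid.inv_right[OF G, of a] groupoid.ini_in[OF G, of a]
    unfolding ia edges_def edge_inv_def edge_comp_def by auto
qed

lemma edge_ini_comp:
  assumes X: "is_chamber_system M X" and i: "i \<in> edges M X" and j: "j \<in> edges M X"
    and s: "fst i = fst j" and ij: "edge_ter X i = edge_ini X j"
  shows "edge_ini X (edge_comp X i j) = edge_ini X i"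
  using groupoid.ini_comp[OF panel_groupoid_of_edge[OF X i] edge_arrow[OF i]] edge_arrow[OF j] s ij
  by (simp add: edge_comp_def edge_ini_def edge_ter_def)

lemma edge_ter_comp:
  assumes X: "is_chamber_system M X" and i: "i \<in> edges M X" and j: "j \<in> edges M X"
    and s: "fst i = fst j" and ij: "edge_ter X i = edge_ini X j"
  shows "edge_ter X (edge_comp X i j) = edge_ter X j"
  using groupoid.ter_comp[OF panel_groupoid_of_edge[OF X i] edge_arrow[OF i]] edge_arrow[OF j] s ij
  by (simp add: edge_comp_def edge_ini_def edge_ter_def)

lemmas edge_comp_props = edge_comp_in_iff edge_ini_comp edge_ter_comp

section \<open>Galleries as walks\<close>

lemma gal_ter_Nil [simp]: "gal_ter X (C, []) = C"
  by (simp add: gal_ter_def)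

text \<open>\<open>gal_ter\<close> is defined through the last edge; this form follows the recursion
  of \<open>walk\<close> and so permits induction on edge lists.\<close>

lemma gal_ter_Cons [simp]: "gal_ter X (C, i # es) = gal_ter X (edge_ter X i, es)"
  by (simp add: gal_ter_def)

lemma gal_ter_append [simp]: "gal_ter X (C, u @ v) = gal_ter X (gal_ter X (C, u), v)"
  by (induction u arbitrary: C) auto

lemma galleries_iff [simp]: "(C, es) \<in> galleries M X \<longleftrightarrow> walk M X C es"
  by (simp add: galleries_def)

lemma walk_start: "is_chamber_system M X \<Longrightarrow> walk M X C es \<Longrightarrow> C \<in> chambers X"
  by (cases es) (auto dest: edge_ini_in)

lemma walk_end: "walk M X C es \<Longrightarrow> gal_ter X (C, es) \<in> chambers X"
  by (induction es arbitrary: C) auto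

lemma walk_edges: "walk M X C es \<Longrightarrow> set es \<subseteq> edges M X"
  by (induction es arbitrary: C) auto

lemma walk_append:
  assumes "is_chamber_system M X"
  shows "walk M X C (u @ v) \<longleftrightarrow> walk M X C u \<and> walk M X (gal_ter X (C, u)) v"
  using assms by (induction u arbitrary: C) (auto dest: walk_start)


section \<open>Homotopy\<close>

text \<open>Each move replaces a subgallery by one with the same ends: an edge followed by its
  inverse returns to its start, a composite keeps the outer ends, and a defining suite is a cycle.
  The rules ask only that the longer side be a gallery, so the shorter side has to be
  checked.\<close>

lemma elementary_homotopy_invariants:
  assumes "is_weyl_data M X" and "elementary_homotopy M X \<beta> \<gamma>"
  shows "\<beta> \<in> galleries M X \<and> \<gamma> \<in> galleries M X \<and> fst \<beta> = fst \<gamma> \<and> gal_ter X \<beta> = gal_ter X \<gamma>"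
proof -
  have X: "is_chamber_system M X" using assms(1) by (simp add: is_weyl_data_def)
  show ?thesis
    using assms(2)
  proof cases
    case (delete_inverse C u i v)
    then show ?thesis by (auto simp: walk_append[OF X] edge_inv_props[OF X] walk_end)
  next
    case (merge C u i j v)
    then show ?thesis
      by (auto simp: walk_append[OF X] edge_comp_props[OF X])
  next
    case (delete_suite C u d v)
    then have "gal_ter X (gal_ter X (C, u), d) = gal_ter X (C, u)"
      using assms(1) unfolding defining_suites_def is_weyl_data_def is_st_cycle_def is_cycle_def
        gal_ini_def by force
    with delete_suite show ?thesis by (auto simp: walk_append[OF X] simp del: gal_ter_Cons)
  qed
qed

lemmas elementary_homotopy_props =
  elementary_homotopy_invariants[THEN conjunct1]
  elementary_homotopy_invariants[THEN conjunct2, THEN conjunct1]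
  elementary_homotopy_invariants[THEN conjunct2, THEN conjunct2, THEN conjunct1]
  elementary_homotopy_invariants[THEN conjunct2, THEN conjunct2, THEN conjunct2]

lemma homotopic_refl: "\<beta> \<in> galleries M X \<Longrightarrow> homotopic M X \<beta> \<beta>"
  by (simp add: homotopic_def)

lemma homotopic_sym: "homotopic M X \<beta> \<gamma> \<Longrightarrow> homotopic M X \<gamma> \<beta>"
  by (simp add: homotopic_def equivclp_sym)

lemma homotopic_trans:
  "homotopic M X \<beta> \<gamma> \<Longrightarrow> homotopic M X \<gamma> \<delta> \<Longrightarrow> homotopic M X \<beta> \<delta>"
  unfolding homotopic_def by (blast intro: equivclp_trans)

lemma elementary_homotopic:
  "is_weyl_data M X \<Longrightarrow> elementary_homotopy M X \<beta> \<gamma> \<Longrightarrow> homotopic M X \<beta> \<gamma>"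
  unfolding homotopic_def by (auto dest: elementary_homotopy_props intro: r_into_equivclp)

text \<open>A step may run in either direction, and it may use that the gallery reached so far is
  homotopic to \<beta>, which later pins down its end chambers.\<close>

lemma homotopic_induct [consumes 2, case_names refl step]:
  assumes X: "is_weyl_data M X" and "homotopic M X \<beta> \<gamma>" and "P \<beta>"
    and step: "\<And>\<delta> \<epsilon>. homotopic M X \<beta> \<delta> \<Longrightarrow>
      elementary_homotopy M X \<delta> \<epsilon> \<or> elementary_homotopy M X \<epsilon> \<delta> \<Longrightarrow> P \<delta> \<Longrightarrow> P \<epsilon>"
  shows "P \<gamma>"
proof -
  have \<beta>: "\<beta> \<in> galleries M X" and "equivclp (elementary_homotopy M X) \<beta> \<gamma>"
    using assms(2) by (auto simp: homotopic_def)
  from this(2) have "homotopic M X \<beta> \<gamma> \<and> P \<gamma>"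
  proof (induction rule: equivclp_induct)
    case base
    show ?case using assms(3) \<beta> by (simp add: homotopic_refl)
  next
    case (step \<delta> \<epsilon>)
    then show ?case
      using assms(4) X homotopic_trans homotopic_sym elementary_homotopic by metis
  qed
  then show ?thesis ..
qed

lemma homotopic_ini:
  assumes "is_weyl_data M X" and "homotopic M X \<beta> \<gamma>"
  shows "fst \<beta> = fst \<gamma>"
  using assms
proof (induction rule: homotopic_induct)
  case (step \<delta> \<epsilon>)
  then show ?case using elementary_homotopy_props(3)[OF assms(1)] by metis
qed simp

lemma homotopic_ter:
  assumes "is_weyl_data M X" and "homotopic M X \<beta> \<gamma>"
  shows "gal_ter X \<beta> = gal_ter X \<gamma>"
  using assms
proof (induction rule: homotopic_induct)
  case (step \<delta> \<epsilon>)
  then show ?case using elementary_homotopy_props(4)[OF assms(1)] by metis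
qed simp

text \<open>The same move applies with prefix and suffix enlarged by \<open>u\<close> and
  \<open>v\<close>. For a suite, the chamber at which it is based is unchanged because
  \<open>u\<close> ends where \<beta> starts.\<close>

lemma elementary_homotopy_context:
  assumes X: "is_weyl_data M X" and el: "elementary_homotopy M X \<beta> \<gamma>"
    and u: "walk M X C u" "gal_ter X (C, u) = fst \<beta>" and v: "walk M X (gal_ter X \<beta>) v"
  shows "elementary_homotopy M X (C, u @ snd \<beta> @ v) (C, u @ snd \<gamma> @ v)"
proof -
  have X': "is_chamber_system M X" using X by (simp add: is_weyl_data_def)
  have gal: "(C, u @ snd \<beta> @ v) \<in> galleries M X"
    using elementary_homotopy_props[OF X el] u v
    by (cases \<beta>) (auto simp: walk_append[OF X'])
  from el show ?thesis
  proof cases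
    case (delete_inverse D a i b)
    then show ?thesis
      using elementary_homotopy.delete_inverse[of C "u @ a" i X "b @ v" M] gal by auto
  next
    case (merge D a i j b)
    then show ?thesis
      using elementary_homotopy.merge[of C "u @ a" i j "b @ v" M X] gal by auto
  next
    case (delete_suite D a d b)
    then show ?thesis
      using elementary_homotopy.delete_suite[of C "u @ a" d "b @ v" M X] gal u by auto
  qed
qed

lemma homotopic_context:
  assumes X: "is_weyl_data M X" and h: "homotopic M X \<beta> \<gamma>"
    and u: "walk M X C u" "gal_ter X (C, u) = fst \<beta>" and v: "walk M X (gal_ter X \<beta>) v"
  shows "homotopic M X (C, u @ snd \<beta> @ v) (C, u @ snd \<gamma> @ v)"
  using X h
proof (induction rule: homotopic_induct)
  case refl
  have "is_chamber_system M X" using X by (simp add: is_weyl_data_def)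
  then show ?case
    using h u v by (cases \<beta>) (auto simp: walk_append homotopic_def)
next
  case (step \<delta> \<epsilon>)
  \<comment> \<open>The ends are constant along the homotopy, so \<open>u\<close> and
    \<open>v\<close> still fit around \<delta> and \<epsilon>.\<close>
  have \<delta>: "fst \<beta> = fst \<delta>" "gal_ter X \<beta> = gal_ter X \<delta>"
    using homotopic_ini[OF X step.hyps(1)] homotopic_ter[OF X step.hyps(1)] by auto
  have \<epsilon>: "fst \<delta> = fst \<epsilon>" "gal_ter X \<delta> = gal_ter X \<epsilon>"
    using step.hyps(2) elementary_homotopy_props[OF X] by metis+
  have "homotopic M X (C, u @ snd \<delta> @ v) (C, u @ snd \<epsilon> @ v)"
    using step.hyps(2) elementary_homotopy_context[OF X] elementary_homotopic[OF X]
      homotopic_sym \<delta> \<epsilon> u v by metis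
  then show ?case using step.IH homotopic_trans by blast
qed

text \<open>Morphisms and coverings turn defining suites into suites that need not be defining.
  Deleting such a suite is still a homotopy, though not necessarily a single move.\<close>

lemma suite_context_null:
  assumes X: "is_weyl_data M X" and d: "(gal_ter X (C, u), d) \<in> suites M X"
    and w: "walk M X C (u @ d @ v)"
  shows "homotopic M X (C, u @ d @ v) (C, u @ v)"
proof -
  have X': "is_chamber_system M X" using X by (simp add: is_weyl_data_def)
  obtain D where h: "homotopic M X (gal_ter X (C, u), d) (D, [])"
    using d by (auto simp: suites_def)
  show ?thesis
    using homotopic_context[OF X h, of C u v] w by (simp add: walk_append[OF X'])
qed

section \<open>Homotopy classes as arrows of the fundamental groupoid\<close>

lemma gini_homotopy_class:
  assumes "is_weyl_data M X" and "\<beta> \<in> galleries M X"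
  shows "gini (fundamental_groupoid M X) (homotopy_class M X \<beta>) = fst \<beta>"
proof -
  \<comment> \<open>All representatives share their initial chamber, so the description in
    \<open>gini\<close> has a unique value.\<close>
  have "\<beta> \<in> homotopy_class M X \<beta>" "\<And>\<gamma>. \<gamma> \<in> homotopy_class M X \<beta> \<Longrightarrow> fst \<gamma> = fst \<beta>"
    using homotopic_refl[OF assms(2)] homotopic_ini[OF assms(1), of \<beta>]
    unfolding homotopy_class_def by auto
  then show ?thesis
    unfolding fundamental_groupoid_def gal_ini_def groupoid.simps
    by (intro the_equality) force+
qed

lemma gter_homotopy_class:
  assumes "is_weyl_data M X" and "\<beta> \<in> galleries M X"
  shows "gter (fundamental_groupoid M X) (homotopy_class M X \<beta>) = gal_ter X \<beta>"
proof -
  have "\<beta> \<in> homotopy_class M X \<beta>"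
    "\<And>\<gamma>. \<gamma> \<in> homotopy_class M X \<beta> \<Longrightarrow> gal_ter X \<gamma> = gal_ter X \<beta>"
    using homotopic_refl[OF assms(2)] homotopic_ter[OF assms(1), of \<beta>]
    unfolding homotopy_class_def by (blast, metis mem_Collect_eq)
  then show ?thesis
    unfolding fundamental_groupoid_def groupoid.simps
    by (intro the_equality) force+
qed

lemma homotopy_class_eq_iff:
  assumes "\<beta> \<in> galleries M X"
  shows "homotopy_class M X \<beta> = homotopy_class M X \<gamma> \<longleftrightarrow> homotopic M X \<beta> \<gamma>"
proof
  assume "homotopy_class M X \<beta> = homotopy_class M X \<gamma>"
  then show "homotopic M X \<beta> \<gamma>"
    using homotopic_refl[OF assms] homotopic_sym unfolding homotopy_class_def by blast
next
  assume "homotopic M X \<beta> \<gamma>"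
  then show "homotopy_class M X \<beta> = homotopy_class M X \<gamma>"
    unfolding homotopy_class_def using homotopic_trans homotopic_sym by blast
qed

lemma verts_fundamental_groupoid [simp]: "verts (fundamental_groupoid M X) = chambers X"
  by (simp add: fundamental_groupoid_def)

lemma arrows_fundamental_groupoid [simp]:
  "arrows (fundamental_groupoid M X) = homotopy_class M X ` galleries M X"
  by (simp add: fundamental_groupoid_def)


section \<open>Morphisms\<close>

lemma chamber_morphism_walk:
  assumes "chamber_morphism M X Y \<omega>" and "walk M X C es"
  shows "walk M Y (fst \<omega> C) (map (snd \<omega>) es)"
  using assms by (induction es arbitrary: C) (auto simp: chamber_morphism_def)

lemma chamber_morphism_gal_ter:
  assumes "chamber_morphism M X Y \<omega>" and "walk M X C es"
  shows "gal_ter Y (fst \<omega> C, map (snd \<omega>) es) = fst \<omega> (gal_ter X (C, es))"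
  using assms by (induction es arbitrary: C) (auto simp: chamber_morphism_def)

text \<open>If the images were mutually inverse, their composite would be an identity; but it is the
  image of the edge \<open>edge_comp X i j\<close>. Thus merges are mapped to merges, never to
  cancellations.\<close>

lemma chamber_morphism_not_inv:
  assumes X: "is_chamber_system M X" and Y: "is_chamber_system M Y"
    and \<omega>: "chamber_morphism M X Y \<omega>"
    and ij: "i \<in> edges M X" "j \<in> edges M X" "fst i = fst j" "edge_ter X i = edge_ini X j"
    and ne: "j \<noteq> edge_inv X i"
  shows "snd \<omega> j \<noteq> edge_inv Y (snd \<omega> i)"
proof -
  have "snd \<omega> (edge_comp X i j) \<in> edges M Y"
    using \<omega> edge_comp_props(1)[OF X ij] ne by (auto simp: chamber_morphism_def)
  moreover have "snd \<omega> (edge_comp X i j) = edge_comp Y (snd \<omega> i) (snd \<omega> j)"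
    using \<omega> ij ne by (auto simp: chamber_morphism_def)
  moreover have "snd \<omega> i \<in> edges M Y" "snd \<omega> j \<in> edges M Y" "fst (snd \<omega> i) = fst (snd \<omega> j)"
    "edge_ter Y (snd \<omega> i) = edge_ini Y (snd \<omega> j)"
    using \<omega> ij by (auto simp: chamber_morphism_def)
  ultimately show ?thesis using edge_comp_props(1)[OF Y] by metis
qed

text \<open>Cancellations and merges become moves of the same kind. A defining suite becomes a suite
  only, so its deletion may turn into several moves.\<close>

lemma weyl_morphism_elementary:
  assumes X: "is_weyl_data M X" and Y: "is_weyl_data M Y" and \<omega>: "weyl_morphism M X Y \<omega>"
    and el: "elementary_homotopy M X \<beta> \<gamma>"
  shows "homotopic M Y (gal_map \<omega> \<beta>) (gal_map \<omega> \<gamma>)"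
proof -
  have X': "is_chamber_system M X" and Y': "is_chamber_system M Y"
    using X Y by (auto simp: is_weyl_data_def)
  have \<omega>': "chamber_morphism M X Y \<omega>" using \<omega> by (simp add: weyl_morphism_def)
  note pm = chamber_morphism_walk[OF \<omega>'] chamber_morphism_gal_ter[OF \<omega>']
  from el show ?thesis
  proof cases
    case (delete_inverse C u i v)
    then have "i \<in> edges M X" by (simp add: walk_append[OF X'])
    then have inv: "snd \<omega> (edge_inv X i) = edge_inv Y (snd \<omega> i)"
      using \<omega>' by (simp add: chamber_morphism_def)
    show ?thesis
      unfolding delete_inverse(1,2) gal_map_def
      using elementary_homotopy.delete_inverse[of "fst \<omega> C" "map (snd \<omega>) u" "snd \<omega> i" Y
          "map (snd \<omega>) v" M] pm(1)[of C "u @ [i, edge_inv X i] @ v"] delete_inverse(3)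
      by (auto intro: elementary_homotopic[OF Y] simp: inv)
  next
    case (merge C u i j v)
    then have ij: "i \<in> edges M X" "j \<in> edges M X" "edge_ter X i = edge_ini X j"
      by (auto simp: walk_append[OF X'])
    then have comp: "snd \<omega> (edge_comp X i j) = edge_comp Y (snd \<omega> i) (snd \<omega> j)"
      "fst (snd \<omega> i) = fst (snd \<omega> j)"
      using \<omega>' merge by (auto simp: chamber_morphism_def)
    have "elementary_homotopy M Y
        (fst \<omega> C, map (snd \<omega>) u @ [snd \<omega> i, snd \<omega> j] @ map (snd \<omega>) v)
        (fst \<omega> C, map (snd \<omega>) u @ [edge_comp Y (snd \<omega> i) (snd \<omega> j)] @ map (snd \<omega>) v)"
      using pm(1)[of C "u @ [i, j] @ v"] merge comp
        chamber_morphism_not_inv[OF X' Y' \<omega>' ij(1,2) _ ij(3)]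
      by (intro elementary_homotopy.merge) auto
    then show ?thesis
      unfolding merge(1,2) gal_map_def using comp
      by (auto intro: elementary_homotopic[OF Y])
  next
    case (delete_suite C u d v)
    then have "(fst \<omega> (gal_ter X (C, u)), map (snd \<omega>) d) \<in> suites M Y"
      using \<omega> by (force simp: weyl_morphism_def gal_map_def)
    then show ?thesis
      unfolding delete_suite(1,2) gal_map_def
      using suite_context_null[OF Y, of "fst \<omega> C" "map (snd \<omega>) u" "map (snd \<omega>) d" "map (snd \<omega>) v"]
        pm(1)[of C "u @ d @ v"] pm(2)[of C u] delete_suite(3)
      by (auto simp: walk_append[OF X'])
  qed
qed

lemma weyl_morphism_homotopic:
  assumes X: "is_weyl_data M X" and Y: "is_weyl_data M Y" and \<omega>: "weyl_morphism M X Y \<omega>"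
    and h: "homotopic M X \<beta> \<gamma>"
  shows "homotopic M Y (gal_map \<omega> \<beta>) (gal_map \<omega> \<gamma>)"
  using X h
proof (induction rule: homotopic_induct)
  case refl
  show ?case
    using h \<omega> chamber_morphism_walk[of M X Y \<omega>] unfolding weyl_morphism_def
    by (cases \<beta>) (auto simp: homotopic_def gal_map_def)
next
  case (step \<delta> \<epsilon>)
  then show ?case
    using weyl_morphism_elementary[OF X Y \<omega>] homotopic_sym homotopic_trans by metis
qed

lemma weyl_morphism_gallery:
  assumes "weyl_morphism M X Y \<omega>" and "\<beta> \<in> galleries M X"
  shows "gal_map \<omega> \<beta> \<in> galleries M Y"
  using assms chamber_morphism_walk[of M X Y \<omega>]
  by (cases \<beta>) (auto simp: weyl_morphism_def gal_map_def)

text \<open>Homotopic galleries have homotopic images, so the union in \<open>induced_hom\<close> is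
  a union of copies of one class.\<close>

lemma induced_hom_class:
  assumes X: "is_weyl_data M X" and Y: "is_weyl_data M Y" and \<omega>: "weyl_morphism M X Y \<omega>"
    and \<beta>: "\<beta> \<in> galleries M X"
  shows "snd (induced_hom M X Y \<omega>) (homotopy_class M X \<beta>) = homotopy_class M Y (gal_map \<omega> \<beta>)"
proof -
  have "homotopy_class M Y (gal_map \<omega> \<gamma>) = homotopy_class M Y (gal_map \<omega> \<beta>)"
    if "\<gamma> \<in> homotopy_class M X \<beta>" for \<gamma>
    using that weyl_morphism_homotopic[OF X Y \<omega>, of \<beta> \<gamma>]
      homotopy_class_eq_iff[OF weyl_morphism_gallery[OF \<omega> \<beta>]]
    unfolding homotopy_class_def[of M X] by fastforce
  moreover have "\<beta> \<in> homotopy_class M X \<beta>"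
    using \<beta> by (simp add: homotopy_class_def homotopic_refl)
  ultimately have "(\<Union>\<gamma>\<in>homotopy_class M X \<beta>. homotopy_class M Y (gal_map \<omega> \<gamma>)) =
      homotopy_class M Y (gal_map \<omega> \<beta>)" by blast
  then show ?thesis using \<beta> by (simp add: induced_hom_def)
qed


section \<open>Lifting along coverings\<close>

lemma covering_source: "covering M X Y p \<Longrightarrow> is_weyl_data M X"
  by (simp add: covering_def)

lemma covering_target: "covering M X Y p \<Longrightarrow> is_weyl_data M Y"
  by (simp add: covering_def)

lemma weyl_data_chamber_system: "is_weyl_data M X \<Longrightarrow> is_chamber_system M X"
  by (simp add: is_weyl_data_def)

lemma covering_weyl_morphism: "covering M X Y p \<Longrightarrow> weyl_morphism M X Y p"
  by (simp add: covering_def)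

lemma weyl_chamber_morphism: "weyl_morphism M X Y p \<Longrightarrow> chamber_morphism M X Y p"
  by (simp add: weyl_morphism_def)

lemmas coveringD = covering_source covering_target
  covering_source[THEN weyl_data_chamber_system] covering_target[THEN weyl_data_chamber_system]
  covering_weyl_morphism covering_weyl_morphism[THEN weyl_chamber_morphism]

text \<open>This is injectivity of the local bijection at the common initial chamber. It reduces
  equality of edges of a covering to equality of their initial chambers and of their
  projections.\<close>

lemma edge_lift_unique:
  assumes "covering M X Y p" and "i \<in> edges M X" "j \<in> edges M X"
    and "edge_ini X i = edge_ini X j" and "snd p i = snd p j"
  shows "i = j"
proof -
  have "edge_ini X i \<in> chambers X" using coveringD(3)[OF assms(1)] assms(2) by (rule edge_ini_in)
  then have "inj_on (snd p) {k \<in> edges M X. edge_ini X k = edge_ini X i}"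
    using assms(1) by (auto simp: covering_def surjective_etale_def bij_betw_def)
  then show ?thesis using assms by (auto dest: inj_onD)
qed

lemma edge_lift_exists:
  assumes "covering M X Y p" and "C \<in> chambers X" and "k \<in> edges M Y" "edge_ini Y k = fst p C"
  shows "\<exists>i\<in>edges M X. edge_ini X i = C \<and> snd p i = k"
proof -
  have "snd p ` {i \<in> edges M X. edge_ini X i = C} = {i \<in> edges M Y. edge_ini Y i = fst p C}"
    using assms(1,2) by (auto simp: covering_def surjective_etale_def bij_betw_def)
  moreover have "k \<in> {i \<in> edges M Y. edge_ini Y i = fst p C}"
    using assms(3,4) by simp
  ultimately have "k \<in> snd p ` {i \<in> edges M X. edge_ini X i = C}" by simp
  then show ?thesis by auto
qed

section \<open>Existence and uniqueness of lifted galleries\<close>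

lemma walk_lift_exists:
  assumes p: "covering M X Y p" and "C \<in> chambers X" and "walk M Y (fst p C) es"
  shows "\<exists>fs. walk M X C fs \<and> map (snd p) fs = es"
  using assms(2,3)
proof (induction es arbitrary: C)
  case (Cons k es)
  then obtain i where i: "i \<in> edges M X" "edge_ini X i = C" "snd p i = k"
    using edge_lift_exists[OF p] by (metis walk.simps(2))
  \<comment> \<open>The rest of the gallery starts below the end of the lifted edge, which is the
    chamber at which the induction continues.\<close>
  then have "edge_ter Y k = fst p (edge_ter X i)"
    using coveringD(6)[OF p] by (auto simp: chamber_morphism_def)
  then obtain fs where "walk M X (edge_ter X i) fs" "map (snd p) fs = es"
    using Cons.IH[OF edge_ter_in[OF coveringD(3)[OF p] i(1)]] Cons.prems by auto
  then have "walk M X C (i # fs) \<and> map (snd p) (i # fs) = k # es" using i by auto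
  then show ?case by (rule exI)
qed simp

lemma walk_lift_unique:
  assumes p: "covering M X Y p" and "walk M X C es" "walk M X C fs"
    and "map (snd p) es = map (snd p) fs"
  shows "es = fs"
  using assms(2-)
proof (induction es arbitrary: C fs)
  case (Cons i es)
  then obtain j fs' where "fs = j # fs'" by (cases fs) auto
  with Cons show ?case using edge_lift_unique[OF p, of i j] by auto
qed simp

text \<open>The longer side of the move is already lifted to \<beta>, so the edges involved have
  lifts there, and the move can be repeated on them. Over a defining suite lies only a suite, hence
  the claim of a homotopy instead of one move.\<close>

lemma elementary_homotopy_lift:
  assumes p: "covering M X Y p" and \<beta>: "\<beta> \<in> galleries M X"
    and el: "elementary_homotopy M Y (gal_map p \<beta>) \<gamma>"
  shows "\<exists>\<beta>'. homotopic M X \<beta> \<beta>' \<and> gal_map p \<beta>' = \<gamma>"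
proof -
  note X = coveringD(1)[OF p] and X' = coveringD(3)[OF p] and p' = coveringD(6)[OF p]
  obtain C es where \<beta>C: "\<beta> = (C, es)" by (cases \<beta>)
  then have w: "walk M X C es" using \<beta> by simp
  from el show ?thesis
  proof cases
    case (delete_inverse D u k v)
    then obtain a i j b where es: "es = a @ [i, j] @ b"
      and m: "map (snd p) a = u" "snd p i = k" "snd p j = edge_inv Y k" "map (snd p) b = v"
      and D: "D = fst p C"
      by (auto simp: \<beta>C gal_map_def map_eq_append_conv map_eq_Cons_conv)
    have ij: "i \<in> edges M X" "j \<in> edges M X" "edge_ini X j = edge_ter X i"
      using w by (auto simp: es walk_append[OF X'])
    \<comment> \<open>Both \<open>j\<close> and \<open>edge_inv X i\<close> start at the end of
      \<open>i\<close> and lie over \<open>edge_inv Y k\<close>.\<close>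
    then have "snd p j = snd p (edge_inv X i)"
      using p' m by (auto simp: chamber_morphism_def)
    then have "j = edge_inv X i"
      using edge_lift_unique[OF p ij(2), of "edge_inv X i"] ij edge_inv_props[OF X' ij(1)] by simp
    then have "elementary_homotopy M X (C, es) (C, a @ b)"
      using w elementary_homotopy.delete_inverse[of C a i X b M] by (simp add: es)
    then show ?thesis
      using elementary_homotopic[OF X] delete_inverse m D
      by (intro exI[of _ "(C, a @ b)"]) (auto simp: \<beta>C gal_map_def)
  next
    case (merge D u k l v)
    then obtain a i j b where es: "es = a @ [i, j] @ b"
      and m: "map (snd p) a = u" "snd p i = k" "snd p j = l" "map (snd p) b = v"
      and D: "D = fst p C"
      by (auto simp: \<beta>C gal_map_def map_eq_append_conv map_eq_Cons_conv)
    have ij: "i \<in> edges M X" "j \<in> edges M X" "edge_ini X j = edge_ter X i"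
      using w by (auto simp: es walk_append[OF X'])
    \<comment> \<open>If \<open>j\<close> were inverse to \<open>i\<close>, then \<open>l\<close>
      would be inverse to \<open>k\<close>, which the merge rule excludes.\<close>
    have s: "fst i = fst j" and ne: "j \<noteq> edge_inv X i"
      using p' ij merge m by (auto simp: chamber_morphism_def)
    then have comp: "snd p (edge_comp X i j) = edge_comp Y k l"
      using p' ij m by (auto simp: chamber_morphism_def)
    have "elementary_homotopy M X (C, es) (C, a @ [edge_comp X i j] @ b)"
      using w elementary_homotopy.merge[of C a i j b M X] s ne by (simp add: es)
    then show ?thesis
      using elementary_homotopic[OF X] merge m D comp
      by (intro exI[of _ "(C, a @ [edge_comp X i j] @ b)"]) (auto simp: \<beta>C gal_map_def)
  next
    case (delete_suite D u d v)
    then obtain a c b where es: "es = a @ c @ b"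
      and m: "map (snd p) a = u" "map (snd p) c = d" "map (snd p) b = v"
      and D: "D = fst p C"
      by (auto simp: \<beta>C gal_map_def map_eq_append_conv append_eq_map_conv)
    have wa: "walk M X C a" and wc: "walk M X (gal_ter X (C, a)) c"
      using w by (auto simp: es walk_append[OF X'])
    \<comment> \<open>The lifting clause of \<open>covering\<close> takes any gallery over a
      defining suite; that \<open>c\<close> closes up is part of its conclusion.\<close>
    have "gal_map p (gal_ter X (C, a), c) \<in> defining_suites M Y"
      using delete_suite chamber_morphism_gal_ter[OF p' wa] m D by (auto simp: gal_map_def)
    then have "(gal_ter X (C, a), c) \<in> suites M X"
      using p wc by (simp add: covering_def)
    then have "homotopic M X (C, es) (C, a @ b)"
      using suite_context_null[OF X] w es by simp
    then show ?thesis
      using delete_suite m D by (intro exI[of _ "(C, a @ b)"]) (auto simp: \<beta>C gal_map_def)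
  qed
qed

lemma gal_map_lift_unique:
  assumes p: "covering M X Y p" and "\<beta> \<in> galleries M X" "\<gamma> \<in> galleries M X"
    and "fst \<beta> = fst \<gamma>" and "gal_map p \<beta> = gal_map p \<gamma>"
  shows "\<beta> = \<gamma>"
proof -
  have "walk M X (fst \<beta>) (snd \<beta>)" "walk M X (fst \<beta>) (snd \<gamma>)"
    using assms(2-4) by (cases \<beta>, simp, cases \<gamma>, simp)
  moreover have "map (snd p) (snd \<beta>) = map (snd p) (snd \<gamma>)"
    using assms(5) by (simp add: gal_map_def)
  ultimately have "snd \<beta> = snd \<gamma>" by (rule walk_lift_unique[OF p])
  then show ?thesis using assms(4) by (simp add: prod_eq_iff)
qed

text \<open>For an inverse move, lift the larger gallery and apply the forward case to it.\<close>

lemma elementary_homotopy_lift_back: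
  assumes p: "covering M X Y p" and \<beta>: "\<beta> \<in> galleries M X"
    and el: "elementary_homotopy M Y \<gamma> (gal_map p \<beta>)"
  shows "\<exists>\<beta>'. homotopic M X \<beta> \<beta>' \<and> gal_map p \<beta>' = \<gamma>"
proof -
  note X = coveringD(1)[OF p]
  have \<gamma>: "\<gamma> \<in> galleries M Y" "fst \<gamma> = fst p (fst \<beta>)"
    using elementary_homotopy_props[OF coveringD(2)[OF p] el] by (auto simp: gal_map_def)
  have "fst \<beta> \<in> chambers X"
    using \<beta> walk_start[OF coveringD(3)[OF p]] by (cases \<beta>) auto
  then obtain fs where fs: "walk M X (fst \<beta>) fs" "map (snd p) fs = snd \<gamma>"
    using walk_lift_exists[OF p, of "fst \<beta>" "snd \<gamma>"] \<gamma> by (cases \<gamma>) auto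
  define \<delta> where "\<delta> = (fst \<beta>, fs)"
  have \<delta>: "\<delta> \<in> galleries M X" "gal_map p \<delta> = \<gamma>" "fst \<delta> = fst \<beta>"
    using fs \<gamma> by (auto simp: \<delta>_def gal_map_def prod_eq_iff)
  then obtain \<epsilon> where \<epsilon>: "homotopic M X \<delta> \<epsilon>" "gal_map p \<epsilon> = gal_map p \<beta>"
    using elementary_homotopy_lift[OF p \<delta>(1)] el by metis
  \<comment> \<open>\<epsilon> starts at the same chamber as \<beta> and has the same
    projection.\<close>
  have "\<epsilon> = \<beta>"
    using gal_map_lift_unique[OF p _ \<beta>, of \<epsilon>] \<epsilon> \<delta> homotopic_ini[OF X \<epsilon>(1)]
    by (auto simp: homotopic_def)
  then show ?thesis using \<epsilon> \<delta> homotopic_sym by blast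
qed

text \<open>Lifting the homotopy move by move from \<beta> ends at a gallery that has the projection
  and the initial chamber of \<gamma>, hence at \<gamma>. In terms of groupoids, the map induced by
  \<open>p\<close> is injective on the arrows issuing from a chamber.\<close>

lemma homotopic_lift:
  assumes p: "covering M X Y p" and \<beta>: "\<beta> \<in> galleries M X" and \<gamma>: "\<gamma> \<in> galleries M X"
    and ini: "fst \<beta> = fst \<gamma>" and h: "homotopic M Y (gal_map p \<beta>) (gal_map p \<gamma>)"
  shows "homotopic M X \<beta> \<gamma>"
proof -
  note X = coveringD(1)[OF p]
  have "\<exists>\<beta>'. homotopic M X \<beta> \<beta>' \<and> gal_map p \<beta>' = gal_map p \<gamma>"
    using coveringD(2)[OF p] h
  proof (induction rule: homotopic_induct)
    case refl
    then show ?case using \<beta> homotopic_refl by blast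
  next
    case (step \<delta> \<epsilon>)
    then obtain \<beta>' where \<beta>': "homotopic M X \<beta> \<beta>'" "gal_map p \<beta>' = \<delta>" by blast
    then have "\<beta>' \<in> galleries M X" by (simp add: homotopic_def)
    then obtain \<beta>'' where "homotopic M X \<beta>' \<beta>''" "gal_map p \<beta>'' = \<epsilon>"
      using step.hyps(2) \<beta>' elementary_homotopy_lift[OF p] elementary_homotopy_lift_back[OF p]
      by blast
    then show ?case using \<beta>' homotopic_trans by blast
  qed
  then obtain \<beta>' where \<beta>': "homotopic M X \<beta> \<beta>'" "gal_map p \<beta>' = gal_map p \<gamma>" by blast
  then have "\<beta>' = \<gamma>"
    using gal_map_lift_unique[OF p _ \<gamma>] homotopic_ini[OF X \<beta>'(1)] ini
    by (auto simp: homotopic_def)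
  then show ?thesis using \<beta>' by simp
qed


section \<open>Morphisms of coverings\<close>

lemma covering_morphism_apply:
  "covering_morphism M X p X' p' \<mu> \<Longrightarrow> i \<in> edges M X \<Longrightarrow> snd p' (snd \<mu> i) = snd p i"
  by (auto simp: covering_morphism_def weyl_compose_def compose_def)

lemma covering_morphism_edge_in:
  "covering_morphism M X p X' p' \<mu> \<Longrightarrow> i \<in> edges M X \<Longrightarrow> snd \<mu> i \<in> edges M X'"
  by (auto simp: covering_morphism_def weyl_morphism_def chamber_morphism_def)

lemma covering_morphism_edge_ini:
  "covering_morphism M X p X' p' \<mu> \<Longrightarrow> i \<in> edges M X \<Longrightarrow>
    edge_ini X' (snd \<mu> i) = fst \<mu> (edge_ini X i)"
  by (auto simp: covering_morphism_def weyl_morphism_def chamber_morphism_def)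

lemmas covering_morphism_edge = covering_morphism_edge_in covering_morphism_edge_ini

text \<open>The image of an edge is the only edge over its projection at the prescribed chamber, so
  the map on chambers determines the map on edges. Extensionality turns agreement on the carriers
  into equality.\<close>

lemma covering_morphism_unique:
  assumes p': "covering M X' W p'" and X: "is_chamber_system M X"
    and \<mu>: "covering_morphism M X p X' p' \<mu>" and \<nu>: "covering_morphism M X p X' p' \<nu>"
    and eq: "\<And>C. C \<in> chambers X \<Longrightarrow> fst \<mu> C = fst \<nu> C"
  shows "\<mu> = \<nu>"
proof -
  have ext: "fst \<mu> \<in> extensional (chambers X)" "snd \<mu> \<in> extensional (edges M X)"
    "fst \<nu> \<in> extensional (chambers X)" "snd \<nu> \<in> extensional (edges M X)"
    using \<mu> \<nu> by (auto simp: covering_morphism_def weyl_morphism_def chamber_morphism_def PiE_def)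
  have "snd \<mu> i = snd \<nu> i" if i: "i \<in> edges M X" for i
    using edge_lift_unique[OF p', of "snd \<mu> i" "snd \<nu> i"] covering_morphism_edge[OF \<mu> i]
      covering_morphism_edge[OF \<nu> i] covering_morphism_apply[OF \<mu> i]
      covering_morphism_apply[OF \<nu> i] eq[OF edge_ini_in[OF X i]] by simp
  then have "snd \<mu> = snd \<nu>" using ext by (intro extensionalityI) auto
  moreover have "fst \<mu> = fst \<nu>" using ext eq by (intro extensionalityI) auto
  ultimately show ?thesis by (simp add: prod_eq_iff)
qed

text \<open>Stated for a homomorphism \<open>l\<close>, so that it serves an isomorphism and, with
  the coverings exchanged, its inverse.\<close>

lemma covering_morphism_exists:
  assumes p: "covering M X W p" and p': "covering M X' W p'"
    and l: "groupoid_hom (fundamental_groupoid M X) (fundamental_groupoid M X') l"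
    and pl: "induced_hom M X W p =
      groupoid_compose (fundamental_groupoid M X) (induced_hom M X' W p') l"
  shows "\<exists>\<mu>. covering_morphism M X p X' p' \<mu> \<and> induced_hom M X X' \<mu> = l"
proof -
  note X = coveringD(1)[OF p] and X' = coveringD(1)[OF p'] and W = coveringD(2)[OF p]
    and cX = coveringD(3)[OF p] and cX' = coveringD(3)[OF p'] and cp = coveringD(6)[OF p]
    and cp' = coveringD(6)[OF p']
  have l0: "fst l \<in> chambers X \<rightarrow>\<^sub>E chambers X'"
    using l by (simp add: groupoid_hom_def)
  have p0: "fst p' (fst l C) = fst p C" if C: "C \<in> chambers X" for C
    using fun_cong[OF arg_cong[OF pl, of fst], of C] C l0
    by (auto simp: induced_hom_def groupoid_compose_def compose_def)
  \<comment> \<open>A representative \<gamma> of the value of \<open>l\<close> on the class of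
    \<beta> makes the conditions on \<open>l\<close> usable for galleries: \<open>l\<close> gives
    its ends, and \<open>pl\<close> makes its projection homotopic to that of \<beta>.\<close>
  have l1: "\<exists>\<gamma>\<in>galleries M X'. snd l (homotopy_class M X \<beta>) = homotopy_class M X' \<gamma> \<and>
      fst \<gamma> = fst l (fst \<beta>) \<and> gal_ter X' \<gamma> = fst l (gal_ter X \<beta>) \<and>
      homotopic M W (gal_map p' \<gamma>) (gal_map p \<beta>)" if \<beta>: "\<beta> \<in> galleries M X" for \<beta>
  proof -
    let ?A = "homotopy_class M X \<beta>"
    have A: "?A \<in> arrows (fundamental_groupoid M X)" using \<beta> by simp
    then have "snd l ?A \<in> homotopy_class M X' ` galleries M X'"
      using l unfolding groupoid_hom_def by (metis PiE_mem arrows_fundamental_groupoid)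
    then obtain \<gamma> where \<gamma>: "\<gamma> \<in> galleries M X'" "snd l ?A = homotopy_class M X' \<gamma>" by blast
    have "gini (fundamental_groupoid M X') (snd l ?A) = fst l (gini (fundamental_groupoid M X) ?A)"
      "gter (fundamental_groupoid M X') (snd l ?A) = fst l (gter (fundamental_groupoid M X) ?A)"
      using l A unfolding groupoid_hom_def by blast+
    then have e: "fst \<gamma> = fst l (fst \<beta>)" "gal_ter X' \<gamma> = fst l (gal_ter X \<beta>)"
      using \<gamma> \<beta> by (simp_all add: gini_homotopy_class gter_homotopy_class X X')
    have "snd (induced_hom M X W p) ?A = snd (induced_hom M X' W p') (snd l ?A)"
      using A by (simp add: pl groupoid_compose_def compose_def)
    then have "homotopy_class M W (gal_map p' \<gamma>) = homotopy_class M W (gal_map p \<beta>)"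
      using induced_hom_class[OF X W coveringD(5)[OF p] \<beta>]
        induced_hom_class[OF X' W coveringD(5)[OF p'] \<gamma>(1)] \<gamma>(2) by simp
    then have "homotopic M W (gal_map p' \<gamma>) (gal_map p \<beta>)"
      using homotopy_class_eq_iff[OF weyl_morphism_gallery[OF coveringD(5)[OF p'] \<gamma>(1)]] by blast
    then show ?thesis using \<gamma> e by blast
  qed
  have "\<exists>j. j \<in> edges M X' \<and> edge_ini X' j = fst l (edge_ini X i) \<and> snd p' j = snd p i"
    if i: "i \<in> edges M X" for i
  proof -
    have C: "edge_ini X i \<in> chambers X" using edge_ini_in[OF cX i] .
    have "snd p i \<in> edges M W" "edge_ini W (snd p i) = fst p' (fst l (edge_ini X i))"
      using cp i p0[OF C] by (auto simp: chamber_morphism_def)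
    moreover have "fst l (edge_ini X i) \<in> chambers X'" using l0 C by auto
    ultimately show ?thesis using edge_lift_exists[OF p'] by blast
  qed
  then obtain m where m: "\<And>i. i \<in> edges M X \<Longrightarrow>
      m i \<in> edges M X' \<and> edge_ini X' (m i) = fst l (edge_ini X i) \<and> snd p' (m i) = snd p i"
    by metis
  define \<mu> where "\<mu> = (fst l, restrict m (edges M X))"
  have \<mu>: "snd \<mu> i \<in> edges M X'" "edge_ini X' (snd \<mu> i) = fst \<mu> (edge_ini X i)"
    "snd p' (snd \<mu> i) = snd p i" if "i \<in> edges M X" for i
    using m[OF that] that by (auto simp: \<mu>_def)
  have ty: "fst (snd \<mu> i) = fst i" if i: "i \<in> edges M X" for i
    using cp cp' \<mu>[OF i] i unfolding chamber_morphism_def by metis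
  have ter: "edge_ter X' (snd \<mu> i) = fst \<mu> (edge_ter X i)" if i: "i \<in> edges M X" for i
  proof -
    have w: "(edge_ini X i, [i]) \<in> galleries M X" using i edge_ter_in[OF cX i] by simp
    from l1[OF this] obtain \<gamma> where \<gamma>: "\<gamma> \<in> galleries M X'" "fst \<gamma> = fst l (edge_ini X i)"
      "gal_ter X' \<gamma> = fst l (edge_ter X i)"
      "homotopic M W (gal_map p' \<gamma>) (gal_map p (edge_ini X i, [i]))" by auto
    let ?j = "(fst \<mu> (edge_ini X i), [snd \<mu> i])"
    have j: "?j \<in> galleries M X'" using \<mu>[OF i] edge_ter_in[OF cX'] by simp
    have "gal_map p' ?j = gal_map p (edge_ini X i, [i])"
      using \<mu>[OF i] p0[OF edge_ini_in[OF cX i]] by (simp add: gal_map_def \<mu>_def)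
    \<comment> \<open>\<gamma> and the one-edge gallery on \<open>snd \<mu> i\<close> have the same
      initial chamber and homotopic projections, so they also end at the same chamber.\<close>
    then have "homotopic M X' \<gamma> ?j"
      using homotopic_lift[OF p' \<gamma>(1) j] \<gamma> by (simp add: \<mu>_def)
    then show ?thesis using homotopic_ter[OF X', of \<gamma> ?j] \<gamma>(3) by (simp add: \<mu>_def)
  qed
  \<comment> \<open>Both sides lie over \<open>edge_inv W (snd p i)\<close>, and \<open>ter\<close>
    shows that they start at the same chamber.\<close>
  have inv: "snd \<mu> (edge_inv X i) = edge_inv X' (snd \<mu> i)" if i: "i \<in> edges M X" for i
  proof (rule edge_lift_unique[OF p'])
    note ii = edge_inv_props[OF cX i] and jj = edge_inv_props[OF cX' \<mu>(1)[OF i]]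
    show "snd \<mu> (edge_inv X i) \<in> edges M X'" using \<mu>(1)[OF ii(1)] .
    show "edge_inv X' (snd \<mu> i) \<in> edges M X'" using jj by simp
    show "edge_ini X' (snd \<mu> (edge_inv X i)) = edge_ini X' (edge_inv X' (snd \<mu> i))"
      using \<mu>(2)[OF ii(1)] ii jj ter[OF i] by simp
    have "snd p' (edge_inv X' (snd \<mu> i)) = edge_inv W (snd p' (snd \<mu> i))"
      using cp' \<mu>(1)[OF i] unfolding chamber_morphism_def by blast
    moreover have "snd p (edge_inv X i) = edge_inv W (snd p i)"
      using cp i unfolding chamber_morphism_def by blast
    ultimately show "snd p' (snd \<mu> (edge_inv X i)) = snd p' (edge_inv X' (snd \<mu> i))"
      using \<mu>(3)[OF ii(1)] \<mu>(3)[OF i] by simp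
  qed
  have comp: "snd \<mu> (edge_comp X i j) = edge_comp X' (snd \<mu> i) (snd \<mu> j)"
    if i: "i \<in> edges M X" and j: "j \<in> edges M X" and s: "fst i = fst j"
      and c: "edge_ter X i = edge_ini X j" and ne: "j \<noteq> edge_inv X i" for i j
  proof (rule edge_lift_unique[OF p'])
    note ij = edge_comp_props[OF cX i j s c]
    have s': "fst (snd \<mu> i) = fst (snd \<mu> j)" using ty i j s by simp
    have c': "edge_ter X' (snd \<mu> i) = edge_ini X' (snd \<mu> j)" using ter[OF i] \<mu>(2)[OF j] c by simp
    \<comment> \<open>A mutually inverse pair in \<open>X'\<close> would project to one in
      \<open>W\<close>, whereas \<open>p\<close> sends \<open>i\<close> and \<open>j\<close> to
      edges that are not mutually inverse.\<close>
    have ne': "snd \<mu> j \<noteq> edge_inv X' (snd \<mu> i)"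
    proof
      assume "snd \<mu> j = edge_inv X' (snd \<mu> i)"
      then have "snd p j = edge_inv W (snd p i)"
        using \<mu>(1,3) i j cp' unfolding chamber_morphism_def by metis
      then show False using chamber_morphism_not_inv[OF cX coveringD(4)[OF p] cp i j s c ne] by blast
    qed
    note ij' = edge_comp_props[OF cX' \<mu>(1)[OF i] \<mu>(1)[OF j] s' c']
    have e: "edge_comp X i j \<in> edges M X" using ij ne by blast
    show "snd \<mu> (edge_comp X i j) \<in> edges M X'" using \<mu>(1)[OF e] .
    show "edge_comp X' (snd \<mu> i) (snd \<mu> j) \<in> edges M X'" using ij' ne' by blast
    show "edge_ini X' (snd \<mu> (edge_comp X i j)) = edge_ini X' (edge_comp X' (snd \<mu> i) (snd \<mu> j))"
      using \<mu>(2)[OF e] \<mu>(2)[OF i] ij ij' by simp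
    have "snd p (edge_comp X i j) = edge_comp W (snd p i) (snd p j)"
      using cp i j s c ne unfolding chamber_morphism_def by blast
    moreover have "snd p' (edge_comp X' (snd \<mu> i) (snd \<mu> j)) =
        edge_comp W (snd p' (snd \<mu> i)) (snd p' (snd \<mu> j))"
      using cp' \<mu>(1)[OF i] \<mu>(1)[OF j] s' c' ne' unfolding chamber_morphism_def by blast
    ultimately show "snd p' (snd \<mu> (edge_comp X i j)) = snd p' (edge_comp X' (snd \<mu> i) (snd \<mu> j))"
      using \<mu>(3)[OF e] \<mu>(3)[OF i] \<mu>(3)[OF j] by simp
  qed
  have cm: "chamber_morphism M X X' \<mu>"
    unfolding chamber_morphism_def using \<mu>(1,2) ty ter inv comp l0
    by (auto simp: \<mu>_def)
  have gal: "gal_map \<mu> \<beta> \<in> galleries M X'" if "\<beta> \<in> galleries M X" for \<beta>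
    using that chamber_morphism_walk[OF cm] by (cases \<beta>) (simp add: gal_map_def)
  have pg: "gal_map p' (gal_map \<mu> \<beta>) = gal_map p \<beta>" if \<beta>: "\<beta> \<in> galleries M X" for \<beta>
  proof -
    obtain C es where C: "\<beta> = (C, es)" by (cases \<beta>)
    then have "set es \<subseteq> edges M X" "C \<in> chambers X"
      using \<beta> walk_edges[of M X C es] walk_start[OF cX, of C es] by simp_all
    then show ?thesis using \<mu>(3) p0 by (auto simp: C gal_map_def \<mu>_def)
  qed
  \<comment> \<open>The projection of \<beta> is a suite of \<open>W\<close> and contracts to a
    trivial gallery. This trivial gallery is the projection of the one at the start
    \<open>?C\<close> of the image of \<beta>, so the contraction lifts; in particular the image
    closes up.\<close>
  have "gal_map \<mu> \<beta> \<in> suites M X'" if \<beta>: "\<beta> \<in> defining_suites M X" for \<beta>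
  proof -
    obtain s t where st: "is_st_cycle M X s t \<beta>"
      using \<beta> X unfolding defining_suites_def is_weyl_data_def by blast
    then have g: "\<beta> \<in> galleries M X" by (simp add: is_st_cycle_def is_cycle_def)
    have "gal_map p \<beta> \<in> suites M W"
      using coveringD(5)[OF p] \<beta> by (simp add: weyl_morphism_def)
    then obtain D where h: "homotopic M W (gal_map p \<beta>) (D, [])" by (auto simp: suites_def)
    have D: "D = fst p' (fst (gal_map \<mu> \<beta>))"
      using homotopic_ini[OF W h] pg[OF g] by (metis fst_conv gal_map_def)
    let ?C = "fst (gal_map \<mu> \<beta>)"
    have C: "?C \<in> chambers X'" using gal[OF g] walk_start[OF cX'] by (cases "gal_map \<mu> \<beta>") auto
    have h': "homotopic M X' (gal_map \<mu> \<beta>) (?C, [])"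
    proof (rule homotopic_lift[OF p' gal[OF g]])
      show "homotopic M W (gal_map p' (gal_map \<mu> \<beta>)) (gal_map p' (?C, []))"
        unfolding pg[OF g] using h D by (simp add: gal_map_def)
    qed (use C in auto)
    have "fst (gal_map \<mu> \<beta>) = gal_ter X' (gal_map \<mu> \<beta>)"
      using homotopic_ter[OF X' h'] by simp
    moreover have "gal_type (gal_map \<mu> \<beta>) = gal_type \<beta>"
      using g walk_edges[of M X "fst \<beta>" "snd \<beta>"] ty
      by (cases \<beta>) (auto simp: gal_type_def gal_map_def)
    ultimately have "is_st_cycle M X' s t (gal_map \<mu> \<beta>)"
      using st gal[OF g] by (simp add: is_st_cycle_def is_cycle_def gal_ini_def)
    then show ?thesis using h' C unfolding suites_def by blast
  qed
  then have wm: "weyl_morphism M X X' \<mu>" using cm by (simp add: weyl_morphism_def)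
  have "p = weyl_compose M X p' \<mu>"
  proof -
    have "fst p \<in> extensional (chambers X)" "snd p \<in> extensional (edges M X)"
      using cp by (auto simp: chamber_morphism_def PiE_def)
    then have "fst p = compose (chambers X) (fst p') (fst \<mu>)"
      "snd p = compose (edges M X) (snd p') (snd \<mu>)"
      using p0 \<mu>(3) by (auto simp: \<mu>_def compose_def intro!: extensionalityI)
    then show ?thesis by (simp add: weyl_compose_def prod_eq_iff)
  qed
  then have "covering_morphism M X p X' p' \<mu>" using wm by (simp add: covering_morphism_def)
  moreover have "induced_hom M X X' \<mu> = l"
  proof -
    have "snd (induced_hom M X X' \<mu>) (homotopy_class M X \<beta>) = snd l (homotopy_class M X \<beta>)"
      if \<beta>: "\<beta> \<in> galleries M X" for \<beta>
    proof -
      from l1[OF \<beta>] obtain \<gamma> where \<gamma>: "\<gamma> \<in> galleries M X'"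
        "snd l (homotopy_class M X \<beta>) = homotopy_class M X' \<gamma>" "fst \<gamma> = fst l (fst \<beta>)"
        "homotopic M W (gal_map p' \<gamma>) (gal_map p \<beta>)" by blast
      \<comment> \<open>Both galleries start at \<open>fst l (fst \<beta>)\<close> with homotopic
        projections, so they represent the same arrow.\<close>
      have "homotopic M X' \<gamma> (gal_map \<mu> \<beta>)"
      proof (rule homotopic_lift[OF p' \<gamma>(1) gal[OF \<beta>]])
        show "fst \<gamma> = fst (gal_map \<mu> \<beta>)" using \<gamma>(3) by (simp add: gal_map_def \<mu>_def)
        show "homotopic M W (gal_map p' \<gamma>) (gal_map p' (gal_map \<mu> \<beta>))"
          using \<gamma>(4) pg[OF \<beta>] by simp
      qed
      then show ?thesis
        using induced_hom_class[OF X X' wm \<beta>] homotopy_class_eq_iff[OF \<gamma>(1)] \<gamma>(2) by metis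
    qed
    moreover have "snd l \<in> extensional (homotopy_class M X ` galleries M X)"
      using l by (auto simp: groupoid_hom_def PiE_def)
    moreover have "snd (induced_hom M X X' \<mu>) \<in> extensional (homotopy_class M X ` galleries M X)"
      by (simp add: induced_hom_def)
    ultimately have "snd (induced_hom M X X' \<mu>) = snd l"
      by (intro extensionalityI) auto
    moreover have "fst (induced_hom M X X' \<mu>) = fst l"
      using l0 by (auto simp: induced_hom_def \<mu>_def PiE_def extensional_restrict)
    ultimately show ?thesis by (simp add: prod_eq_iff)
  qed
  ultimately show ?thesis by blast
qed

text \<open>Being inverse on chambers suffices: the composite returns an edge with the original
  initial chamber and the original projection to \<open>W\<close>, hence the original edge.\<close>

lemma covering_morphism_inverse:
  assumes p: "covering M X W p"
    and \<mu>: "covering_morphism M X p X' p' \<mu>" and \<nu>: "covering_morphism M X' p' X p \<nu>"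
    and inv: "\<And>C. C \<in> chambers X \<Longrightarrow> fst \<nu> (fst \<mu> C) = C"
  shows "weyl_compose M X \<nu> \<mu> = weyl_ident M X"
proof -
  note X = coveringD(3)[OF p]
  have "snd \<nu> (snd \<mu> i) = i" if i: "i \<in> edges M X" for i
  proof -
    note \<mu>i = covering_morphism_edge[OF \<mu> i]
    note \<nu>i = covering_morphism_edge[OF \<nu> \<mu>i(1)]
    show ?thesis
      using edge_lift_unique[OF p \<nu>i(1) i] \<nu>i(2) \<mu>i(2) inv[OF edge_ini_in[OF X i]]
        covering_morphism_apply[OF \<nu> \<mu>i(1)] covering_morphism_apply[OF \<mu> i] by simp
  qed
  then show ?thesis
    using inv by (auto simp: weyl_compose_def weyl_ident_def compose_def restrict_def)
qed

text \<open>Compose \<open>q\<close>, which is \<open>q'\<close> after \<open>l\<close>, with the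
  right inverse \<open>k\<close> of \<open>l\<close>. Extensionality of \<open>q'\<close> is what
  makes the result an equality of maps. Thus the inverse of an isomorphism over a base again
  respects the projections.\<close>

lemma groupoid_compose_cancel:
  assumes l: "groupoid_hom G H l" and k: "groupoid_hom H G k"
    and lk: "groupoid_compose H l k = groupoid_ident H"
    and q: "q = groupoid_compose G q' l"
    and ext: "fst q' \<in> extensional (verts H)" "snd q' \<in> extensional (arrows H)"
  shows "q' = groupoid_compose H q k"
proof -
  have "fst l (fst k v) = v" if "v \<in> verts H" for v
    using fun_cong[OF arg_cong[OF lk, of fst], of v] that
    by (simp add: groupoid_compose_def groupoid_ident_def compose_def)
  moreover have "snd l (snd k a) = a" if "a \<in> arrows H" for a
    using fun_cong[OF arg_cong[OF lk, of snd], of a] that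
    by (simp add: groupoid_compose_def groupoid_ident_def compose_def)
  moreover have "fst k v \<in> verts G" if "v \<in> verts H" for v
    using k that by (auto simp: groupoid_hom_def)
  moreover have "snd k a \<in> arrows G" if "a \<in> arrows H" for a
    using k that by (auto simp: groupoid_hom_def)
  ultimately have "fst q' = compose (verts H) (fst q) (fst k)"
    "snd q' = compose (arrows H) (snd q) (snd k)"
    using ext by (auto simp: q groupoid_compose_def compose_def intro!: extensionalityI)
  then show ?thesis by (simp add: groupoid_compose_def prod_eq_iff)
qed

text \<open>The inverse \<open>k\<close> of \<open>l\<close> is induced by a morphism of coverings
  \<nu> in the opposite direction. On chambers \<mu> and \<nu> act as \<open>l\<close> and
  \<open>k\<close>, so they are mutually inverse there and therefore on edges.\<close>

lemma covering_morphism_iso: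
  assumes p: "covering M X W p" and p': "covering M X' W p'"
    and l: "groupoid_covering_iso (fundamental_groupoid M X) (induced_hom M X W p)
      (fundamental_groupoid M X') (induced_hom M X' W p') l"
    and \<mu>: "covering_morphism M X p X' p' \<mu>" and ind: "induced_hom M X X' \<mu> = l"
  shows "weyl_iso M X X' \<mu>"
proof -
  let ?G = "fundamental_groupoid M X" and ?H = "fundamental_groupoid M X'"
  obtain k where lk: "groupoid_hom ?G ?H l" "groupoid_hom ?H ?G k"
    "groupoid_compose ?G k l = groupoid_ident ?G" "groupoid_compose ?H l k = groupoid_ident ?H"
    using l unfolding groupoid_covering_iso_def groupoid_iso_def by blast
  have "induced_hom M X' W p' = groupoid_compose ?H (induced_hom M X W p) k"
    using l lk by (intro groupoid_compose_cancel[OF lk(1,2,4)])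
      (auto simp: groupoid_covering_iso_def induced_hom_def)
  from covering_morphism_exists[OF p' p lk(2) this]
  obtain \<nu> where \<nu>: "covering_morphism M X' p' X p \<nu>" "induced_hom M X' X \<nu> = k" by blast
  have \<mu>0: "fst \<mu> C = fst l C" if "C \<in> chambers X" for C
    using that ind by (auto simp: induced_hom_def)
  have \<nu>0: "fst \<nu> C = fst k C" if "C \<in> chambers X'" for C
    using that \<nu>(2) by (auto simp: induced_hom_def)
  have in': "fst l C \<in> chambers X'" if "C \<in> chambers X" for C
    using that lk(1) by (auto simp: groupoid_hom_def)
  have in1: "fst k C \<in> chambers X" if "C \<in> chambers X'" for C
    using that lk(2) by (auto simp: groupoid_hom_def)
  have kl: "fst k (fst l C) = C" if "C \<in> chambers X" for C
    using fun_cong[OF arg_cong[OF lk(3), of fst], of C] that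
    by (simp add: groupoid_compose_def groupoid_ident_def compose_def)
  have lk0: "fst l (fst k C) = C" if "C \<in> chambers X'" for C
    using fun_cong[OF arg_cong[OF lk(4), of fst], of C] that
    by (simp add: groupoid_compose_def groupoid_ident_def compose_def)
  have "weyl_compose M X \<nu> \<mu> = weyl_ident M X"
    using \<mu>0 \<nu>0 kl in' by (intro covering_morphism_inverse[OF p \<mu> \<nu>(1)]) simp
  moreover have "weyl_compose M X' \<mu> \<nu> = weyl_ident M X'"
    using \<mu>0 \<nu>0 lk0 in1 by (intro covering_morphism_inverse[OF p' \<nu>(1) \<mu>]) simp
  ultimately show ?thesis
    using \<mu> \<nu>(1) unfolding weyl_iso_def covering_morphism_def by blast
qed

lemma covering_morphism_ex1:
  assumes p: "covering M X W p" and p': "covering M X' W p'"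
    and l: "groupoid_covering_iso (fundamental_groupoid M X) (induced_hom M X W p)
      (fundamental_groupoid M X') (induced_hom M X' W p') l"
  shows "\<exists>!\<mu>. covering_morphism M X p X' p' \<mu> \<and> induced_hom M X X' \<mu> = l"
proof (rule ex_ex1I)
  show "\<exists>\<mu>. covering_morphism M X p X' p' \<mu> \<and> induced_hom M X X' \<mu> = l"
    using l covering_morphism_exists[OF p p']
    by (simp add: groupoid_covering_iso_def groupoid_iso_def)
next
  fix \<mu> \<nu>
  assume \<mu>: "covering_morphism M X p X' p' \<mu> \<and> induced_hom M X X' \<mu> = l"
    and \<nu>: "covering_morphism M X p X' p' \<nu> \<and> induced_hom M X X' \<nu> = l"
  \<comment> \<open>The induced homomorphism records the map on chambers, which determines a
    morphism of coverings.\<close>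
  then have eq: "fst (induced_hom M X X' \<mu>) = fst (induced_hom M X X' \<nu>)" by simp
  have "fst \<mu> C = fst \<nu> C" if "C \<in> chambers X" for C
    using fun_cong[OF eq, of C] that by (simp add: induced_hom_def)
  then show "\<mu> = \<nu>"
    using covering_morphism_unique[OF p' coveringD(3)[OF p]] \<mu> \<nu> by blast
qed

lemma isomorphic_coverings_if_groupoid_covering_iso:
  assumes p: "covering M X W p" and p': "covering M X' W p'"
    and l: "groupoid_covering_iso (fundamental_groupoid M X) (induced_hom M X W p)
      (fundamental_groupoid M X') (induced_hom M X' W p') l"
  shows "isomorphic_coverings M X p X' p'"
proof -
  obtain \<mu> where \<mu>: "covering_morphism M X p X' p' \<mu>" "induced_hom M X X' \<mu> = l"
    using covering_morphism_ex1[OF p p' l] by (elim ex1E conjE)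
  then have "weyl_iso M X X' \<mu>" by (rule covering_morphism_iso[OF p p' l])
  with \<mu>(1) show ?thesis unfolding isomorphic_coverings_def by (intro exI conjI)
qed

text \<open>The \<open>\<exists>!\<close> clause secures the morphism that the clause on
  \<open>weyl_iso\<close> speaks of, so that the latter is not vacuous.\<close>

theorem corollary4p17p1:
  fixes M :: "'s coxeter_matrix"
    and W :: "('s, 'c, 'e) weyl_data"
    and X :: "('s, 'd, 'f) weyl_data" and p :: "('s, 'd, 'f, 'c, 'e) weyl_map"
    and X' :: "('s, 'g, 'h) weyl_data" and p' :: "('s, 'g, 'h, 'c, 'e) weyl_map"
  assumes "two_weyl_graph M W"
    and "covering M X W p"
    and "covering M X' W p'"
  shows "(\<forall>l. groupoid_covering_iso
              (fundamental_groupoid M X) (induced_hom M X W p)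
              (fundamental_groupoid M X') (induced_hom M X' W p') l \<longrightarrow>
            (\<exists>!\<mu>. covering_morphism M X p X' p' \<mu> \<and> induced_hom M X X' \<mu> = l) \<and>
            (\<forall>\<mu>. covering_morphism M X p X' p' \<mu> \<and> induced_hom M X X' \<mu> = l \<longrightarrow>
               weyl_iso M X X' \<mu>)) \<and>
         ((\<exists>l. groupoid_covering_iso
              (fundamental_groupoid M X) (induced_hom M X W p)
              (fundamental_groupoid M X') (induced_hom M X' W p') l) \<longrightarrow>
            isomorphic_coverings M X p X' p')"
  using covering_morphism_ex1[OF assms(2,3)] covering_morphism_iso[OF assms(2,3)]
    isomorphic_coverings_if_groupoid_covering_iso[OF assms(2,3)]
  by (intro conjI allI impI; (elim exE conjE)?) assumption+

end
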